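(* Let $(M,J,g)$ be an almost Hermitian manifold with fundamental form $F=g(J\cdot,\cdot)$. Let $T$ be the torsion of its Chern connection, $\theta$ its torsion $1$-form, $t$ the anti-symmetrization of $T$, $s^C$ its Chern scalar curvature and $s$ its third scalar curvature. Then $$s^C - s = \tfrac12|\theta|^2+\tfrac12\,\delta^g\theta - \tfrac92|t|^2+\tfrac12|T|^2 .$$
   Context: $M$ has real dimension $m=2n$, $J^2=-1$, $J$ is $g$-orthogonal. The Chern connection $\nabla$ is the unique connection on $TM$ with $\nabla g=0$, $\nabla J=0$ whose torsion $T_{XY}=\nabla_XY-\nabla_YX-[X,Y]$ satisfies $T_{JX,JY}=-T_{XY}$ (equivalently, has no $J$-invariant part). Its curvature is $R_{XY}=[\nabla_X,\nabla_Y]-\nabla_{[X,Y]}$. For a local $g$-orthonormal frame $(e_i)_{i=1}^m$ with $e_{2\alpha}=Je_{2\alpha-1}$: Chern scalar curvature: $s^C=-\frac14\sum_{i,j}g(R_{e_i,Je_i}e_j,Je_j)$. Third scalar curvature: $s=\frac12\sum_{i,j}g(R_{e_i,e_j}e_j,e_i)$. Torsion $1$-form: $\theta=\Lambda(dF)$, i.e. $\theta(X)=\frac12\sum_i dF(e_i,Je_i,X)$; equivalently $\theta(X)=\operatorname{tr}(Z\mapsto T_{XZ})$. $t$ is the $3$-form $t_{XYZ}=\frac13\big(g(X,T_{YZ})+g(Z,T_{XY})+g(Y,T_{ZX})\big)$. Norms: $|T|^2=\frac12\sum_{i,j}|T_{e_ie_j}|^2$ (norm of a $TM$-valued $2$-form),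 $|t|^2=\frac16\sum_{i,j,k}t_{e_ie_je_k}^2$ (usual norm of a $3$-form), $|\theta|^2=\sum_i\theta(e_i)^2$. $\delta^g$ is the codifferential with respect to $g$. *)

theory Defs
  imports "HOL-Analysis.Analysis" "HOL-Library.Function_Algebras"
begin

section \<open>Smooth manifolds\<close>

text \<open>On an open set \<open>S\<close> of a finite-dimensional space, \<open>Ck_on k S f\<close> says that \<open>f\<close> is
  \<open>k\<close> times continuously differentiable on \<open>S\<close>.\<close>

primrec Ck_on :: "nat \<Rightarrow> 'e::euclidean_space set \<Rightarrow> ('e \<Rightarrow> 'f::real_normed_vector) \<Rightarrow> bool" where
  "Ck_on 0 S f \<longleftrightarrow> continuous_on S f"
| "Ck_on (Suc k) S f \<longleftrightarrow> (\<forall>x\<in>S. f differentiable (at x)) \<and>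
     (\<forall>v. Ck_on k S (\<lambda>x. frechet_derivative f (at x) v))"

definition Cinf_on :: "'e::euclidean_space set \<Rightarrow> ('e \<Rightarrow> 'f::real_normed_vector) \<Rightarrow> bool" where
  "Cinf_on S f \<longleftrightarrow> (\<forall>k. Ck_on k S f)"

text \<open>A chart is a pair \<open>(V, \<phi>)\<close> of a coordinate domain \<open>V\<close> and a coordinate map \<open>\<phi>\<close>, of which
  only the values on \<open>V\<close> matter. The dimension of the manifold is that of the model space.\<close>

record ('a, 'e) manifold =
  mtop :: "'a topology"
  charts :: "('a set \<times> ('a \<Rightarrow> 'e)) set"

definition mdim :: "('a, 'e::euclidean_space) manifold \<Rightarrow> nat" where
  "mdim M = DIM('e)"

definition smooth_manifold :: "('a, 'e::euclidean_space) manifold \<Rightarrow> bool" where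
  "smooth_manifold M \<longleftrightarrow>
     Hausdorff_space (mtop M) \<and> second_countable (mtop M) \<and>
     (\<Union>(V, \<phi>)\<in>charts M. V) = topspace (mtop M) \<and>
     (\<forall>(V, \<phi>)\<in>charts M. openin (mtop M) V \<and> open (\<phi> ` V) \<and>
        homeomorphic_map (subtopology (mtop M) V) (top_of_set (\<phi> ` V)) \<phi>) \<and>
     (\<forall>(V, \<phi>)\<in>charts M. \<forall>(W, \<psi>)\<in>charts M. Cinf_on (\<phi> ` (V \<inter> W)) (\<psi> \<circ> inv_into V \<phi>))"

text \<open>For \<open>U\<close> open: the restriction of \<open>f\<close> to \<open>U\<close> is smooth. The values of \<open>f\<close> outside \<open>U\<close>
  are irrelevant.\<close>

definition smooth_fun :: "('a, 'e::euclidean_space) manifold \<Rightarrow> 'a set \<Rightarrow> ('a \<Rightarrow> real) \<Rightarrow> bool" where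
  "smooth_fun M U f \<longleftrightarrow> (\<forall>(V, \<phi>)\<in>charts M. Cinf_on (\<phi> ` (V \<inter> U)) (f \<circ> inv_into V \<phi>))"

definition smooth_near :: "('a, 'e::euclidean_space) manifold \<Rightarrow> 'a \<Rightarrow> ('a \<Rightarrow> real) \<Rightarrow> bool" where
  "smooth_near M p f \<longleftrightarrow> (\<exists>W. openin (mtop M) W \<and> p \<in> W \<and> smooth_fun M W f)"

section \<open>Tangent vectors and vector fields\<close>

text \<open>Tangent vectors at \<open>p\<close> are derivations at \<open>p\<close> of the algebra of germs of smooth functions.
  A derivation is represented by an operator on all functions, which is constrained to depend only
  on the germ at \<open>p\<close> and, so that distinct operators represent distinct tangent vectors, to be
  \<open>0\<close> on the functions that are not smooth near \<open>p\<close>. Addition, subtraction and the zero vector are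
  those of functions, taken pointwise.\<close>

type_synonym 'a tangent = "('a \<Rightarrow> real) \<Rightarrow> real"
type_synonym 'a vfield = "'a \<Rightarrow> 'a tangent"

abbreviation tscale :: "real \<Rightarrow> 'a tangent \<Rightarrow> 'a tangent" (infixr "*\<^sub>T" 75) where
  "c *\<^sub>T v \<equiv> (\<lambda>f. c * v f)"

definition tangent_space :: "('a, 'e::euclidean_space) manifold \<Rightarrow> 'a \<Rightarrow> 'a tangent set" where
  "tangent_space M p = {v.
     (\<forall>f h. smooth_near M p f \<longrightarrow> smooth_near M p h \<longrightarrow>
        v (\<lambda>q. f q + h q) = v f + v h \<and>
        v (\<lambda>q. f q * h q) = f p * v h + h p * v f) \<and>
     (\<forall>c f. smooth_near M p f \<longrightarrow> v (\<lambda>q. c * f q) = c * v f) \<and>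
     (\<forall>f h W. openin (mtop M) W \<longrightarrow> p \<in> W \<longrightarrow> (\<forall>q\<in>W. f q = h q) \<longrightarrow> v f = v h) \<and>
     (\<forall>f. \<not> smooth_near M p f \<longrightarrow> v f = 0)}"

text \<open>Smooth vector fields on the open set \<open>U\<close>; values outside \<open>U\<close> are irrelevant.\<close>

definition vector_fields :: "('a, 'e::euclidean_space) manifold \<Rightarrow> 'a set \<Rightarrow> 'a vfield set" where
  "vector_fields M U = {X.
     (\<forall>p\<in>U. X p \<in> tangent_space M p) \<and>
     (\<forall>W f. openin (mtop M) W \<longrightarrow> W \<subseteq> U \<longrightarrow> smooth_fun M W f \<longrightarrow> smooth_fun M W (\<lambda>q. X q f))}"

definition lie_bracket :: "('a, 'e::euclidean_space) manifold \<Rightarrow> 'a vfield \<Rightarrow> 'a vfield \<Rightarrow> 'a vfield" where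
  "lie_bracket M X Y = (\<lambda>p f.
     if smooth_near M p f then X p (\<lambda>q. Y q f) - Y p (\<lambda>q. X q f) else 0)"

section \<open>Almost Hermitian structures\<close>

type_synonym 'a endo_field = "'a \<Rightarrow> 'a tangent \<Rightarrow> 'a tangent"
type_synonym 'a bilin_field = "'a \<Rightarrow> 'a tangent \<Rightarrow> 'a tangent \<Rightarrow> real"

definition riemannian_metric :: "('a, 'e::euclidean_space) manifold \<Rightarrow> 'a bilin_field \<Rightarrow> bool" where
  "riemannian_metric M g \<longleftrightarrow>
     (\<forall>p\<in>topspace (mtop M). \<forall>u\<in>tangent_space M p. \<forall>v\<in>tangent_space M p.
        (\<forall>w\<in>tangent_space M p. g p (u + v) w = g p u w + g p v w) \<and>
        (\<forall>c. g p (c *\<^sub>T u) v = c * g p u v) \<and>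
        g p u v = g p v u \<and>
        (u \<noteq> 0 \<longrightarrow> g p u u > 0)) \<and>
     (\<forall>U X Y. openin (mtop M) U \<longrightarrow> X \<in> vector_fields M U \<longrightarrow> Y \<in> vector_fields M U \<longrightarrow>
        smooth_fun M U (\<lambda>q. g q (X q) (Y q)))"

definition app_field :: "'a endo_field \<Rightarrow> 'a vfield \<Rightarrow> 'a vfield" where
  "app_field J X = (\<lambda>p. J p (X p))"

definition almost_complex_structure :: "('a, 'e::euclidean_space) manifold \<Rightarrow> 'a endo_field \<Rightarrow> bool" where
  "almost_complex_structure M J \<longleftrightarrow>
     (\<forall>p\<in>topspace (mtop M). \<forall>u\<in>tangent_space M p.
        J p u \<in> tangent_space M p \<and>
        (\<forall>v\<in>tangent_space M p. J p (u + v) = J p u + J p v) \<and>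
        (\<forall>c. J p (c *\<^sub>T u) = c *\<^sub>T J p u) \<and>
        J p (J p u) = - u) \<and>
     (\<forall>U X. openin (mtop M) U \<longrightarrow> X \<in> vector_fields M U \<longrightarrow> app_field J X \<in> vector_fields M U)"

definition almost_hermitian_manifold ::
  "('a, 'e::euclidean_space) manifold \<Rightarrow> 'a endo_field \<Rightarrow> 'a bilin_field \<Rightarrow> bool" where
  "almost_hermitian_manifold M J g \<longleftrightarrow>
     smooth_manifold M \<and> almost_complex_structure M J \<and> riemannian_metric M g \<and>
     (\<forall>p\<in>topspace (mtop M). \<forall>u\<in>tangent_space M p. \<forall>v\<in>tangent_space M p.
        g p (J p u) (J p v) = g p u v)"

definition fundamental_form :: "'a endo_field \<Rightarrow> 'a bilin_field \<Rightarrow> 'a bilin_field" where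
  "fundamental_form J g = (\<lambda>p u v. g p (J p u) v)"

section \<open>Connections on the tangent bundle\<close>

text \<open>A connection is a covariant derivative: \<open>nab p v Y\<close> is \<open>\<nabla>\<^sub>v Y\<close>, a tangent vector at \<open>p\<close>,
  for \<open>v\<close> a tangent vector at \<open>p\<close> and \<open>Y\<close> a vector field on a neighbourhood of \<open>p\<close>. Because
  fields need only be defined near \<open>p\<close>, dependence on the germ of \<open>Y\<close> is one of the axioms.\<close>

type_synonym 'a covd = "'a \<Rightarrow> 'a tangent \<Rightarrow> 'a vfield \<Rightarrow> 'a tangent"

definition cov :: "'a covd \<Rightarrow> 'a vfield \<Rightarrow> 'a vfield \<Rightarrow> 'a vfield" where
  "cov nab X Y = (\<lambda>p. nab p (X p) Y)"

definition connection :: "('a, 'e::euclidean_space) manifold \<Rightarrow> 'a covd \<Rightarrow> bool" where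
  "connection M nab \<longleftrightarrow>
     (\<forall>U Y. openin (mtop M) U \<longrightarrow> Y \<in> vector_fields M U \<longrightarrow>
       (\<forall>p\<in>U. \<forall>v\<in>tangent_space M p.
          nab p v Y \<in> tangent_space M p \<and>
          (\<forall>w\<in>tangent_space M p. nab p (v + w) Y = nab p v Y + nab p w Y) \<and>
          (\<forall>c. nab p (c *\<^sub>T v) Y = c *\<^sub>T nab p v Y) \<and>
          (\<forall>Z\<in>vector_fields M U. nab p v (Y + Z) = nab p v Y + nab p v Z) \<and>
          (\<forall>f. smooth_fun M U f \<longrightarrow>
             nab p v (\<lambda>q. f q *\<^sub>T Y q) = v f *\<^sub>T Y p + f p *\<^sub>T nab p v Y) \<and>
          (\<forall>Z. (\<forall>q\<in>U. Z q = Y q) \<longrightarrow> nab p v Z = nab p v Y)) \<and>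
       (\<forall>X\<in>vector_fields M U. cov nab X Y \<in> vector_fields M U))"

definition metric_connection ::
  "('a, 'e::euclidean_space) manifold \<Rightarrow> 'a bilin_field \<Rightarrow> 'a covd \<Rightarrow> bool" where
  "metric_connection M g nab \<longleftrightarrow>
     (\<forall>U Y Z. openin (mtop M) U \<longrightarrow> Y \<in> vector_fields M U \<longrightarrow> Z \<in> vector_fields M U \<longrightarrow>
       (\<forall>p\<in>U. \<forall>v\<in>tangent_space M p.
          v (\<lambda>q. g q (Y q) (Z q)) = g p (nab p v Y) (Z p) + g p (Y p) (nab p v Z)))"

definition complex_connection ::
  "('a, 'e::euclidean_space) manifold \<Rightarrow> 'a endo_field \<Rightarrow> 'a covd \<Rightarrow> bool" where
  "complex_connection M J nab \<longleftrightarrow>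
     (\<forall>U Y. openin (mtop M) U \<longrightarrow> Y \<in> vector_fields M U \<longrightarrow>
       (\<forall>p\<in>U. \<forall>v\<in>tangent_space M p. nab p v (app_field J Y) = J p (nab p v Y)))"

definition torsion ::
  "('a, 'e::euclidean_space) manifold \<Rightarrow> 'a covd \<Rightarrow> 'a vfield \<Rightarrow> 'a vfield \<Rightarrow> 'a vfield" where
  "torsion M nab X Y = cov nab X Y - cov nab Y X - lie_bracket M X Y"

definition curvature ::
  "('a, 'e::euclidean_space) manifold \<Rightarrow> 'a covd \<Rightarrow> 'a vfield \<Rightarrow> 'a vfield \<Rightarrow> 'a vfield \<Rightarrow> 'a vfield" where
  "curvature M nab X Y Z =
     cov nab X (cov nab Y Z) - cov nab Y (cov nab X Z) - cov nab (lie_bracket M X Y) Z"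

definition levi_civita_connection ::
  "('a, 'e::euclidean_space) manifold \<Rightarrow> 'a bilin_field \<Rightarrow> 'a covd \<Rightarrow> bool" where
  "levi_civita_connection M g D \<longleftrightarrow>
     connection M D \<and> metric_connection M g D \<and>
     (\<forall>U X Y. openin (mtop M) U \<longrightarrow> X \<in> vector_fields M U \<longrightarrow> Y \<in> vector_fields M U \<longrightarrow>
        (\<forall>p\<in>U. torsion M D X Y p = 0))"

definition chern_connection ::
  "('a, 'e::euclidean_space) manifold \<Rightarrow> 'a endo_field \<Rightarrow> 'a bilin_field \<Rightarrow> 'a covd \<Rightarrow> bool" where
  "chern_connection M J g nab \<longleftrightarrow>
     connection M nab \<and> metric_connection M g nab \<and> complex_connection M J nab \<and>
     (\<forall>U X Y. openin (mtop M) U \<longrightarrow> X \<in> vector_fields M U \<longrightarrow> Y \<in> vector_fields M U \<longrightarrow>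
        (\<forall>p\<in>U. torsion M nab (app_field J X) (app_field J Y) p = - torsion M nab X Y p))"

section \<open>Adapted frames and quantities computed in a frame\<close>

text \<open>Local orthonormal frames \<open>e 1, ..., e m\<close> over \<open>U\<close>, where \<open>m\<close> is the dimension, with
  \<open>e (2 \<alpha>) = J (e (2 \<alpha> - 1))\<close>. That the values at each point are a basis amounts to the spanning
  condition, linear independence being a consequence of orthonormality.\<close>

definition adapted_frame ::
  "('a, 'e::euclidean_space) manifold \<Rightarrow> 'a endo_field \<Rightarrow> 'a bilin_field \<Rightarrow> 'a set
    \<Rightarrow> (nat \<Rightarrow> 'a vfield) \<Rightarrow> bool" where
  "adapted_frame M J g U e \<longleftrightarrow>
     openin (mtop M) U \<and>
     (\<forall>i\<in>{1..mdim M}. e i \<in> vector_fields M U) \<and>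
     (\<forall>p\<in>U.
        (\<forall>i\<in>{1..mdim M}. \<forall>j\<in>{1..mdim M}. g p (e i p) (e j p) = (if i = j then 1 else 0)) \<and>
        (\<forall>v\<in>tangent_space M p. \<exists>a. v = (\<Sum>i=1..mdim M. a i *\<^sub>T e i p)) \<and>
        (\<forall>\<alpha>\<in>{1..mdim M div 2}. e (2 * \<alpha>) p = J p (e (2 * \<alpha> - 1) p)))"

definition chern_scalar_curvature ::
  "('a, 'e::euclidean_space) manifold \<Rightarrow> 'a endo_field \<Rightarrow> 'a bilin_field \<Rightarrow> 'a covd
    \<Rightarrow> (nat \<Rightarrow> 'a vfield) \<Rightarrow> 'a \<Rightarrow> real" where
  "chern_scalar_curvature M J g nab e p =
     - (1/4) * (\<Sum>i=1..mdim M. \<Sum>j=1..mdim M.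
        g p (curvature M nab (e i) (app_field J (e i)) (e j) p) (J p (e j p)))"

definition third_scalar_curvature ::
  "('a, 'e::euclidean_space) manifold \<Rightarrow> 'a bilin_field \<Rightarrow> 'a covd
    \<Rightarrow> (nat \<Rightarrow> 'a vfield) \<Rightarrow> 'a \<Rightarrow> real" where
  "third_scalar_curvature M g nab e p =
     (1/2) * (\<Sum>i=1..mdim M. \<Sum>j=1..mdim M.
        g p (curvature M nab (e i) (e j) (e j) p) (e i p))"

text \<open>Exterior derivative of a \<open>2\<close>-form, evaluated on vector fields, normalised without the
  factor \<open>1/3\<close>.\<close>

definition ext_deriv2 ::
  "('a, 'e::euclidean_space) manifold \<Rightarrow> 'a bilin_field
    \<Rightarrow> 'a vfield \<Rightarrow> 'a vfield \<Rightarrow> 'a vfield \<Rightarrow> 'a \<Rightarrow> real" where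
  "ext_deriv2 M \<omega> X Y Z p =
     X p (\<lambda>q. \<omega> q (Y q) (Z q)) - Y p (\<lambda>q. \<omega> q (X q) (Z q)) + Z p (\<lambda>q. \<omega> q (X q) (Y q))
     - \<omega> p (lie_bracket M X Y p) (Z p) + \<omega> p (lie_bracket M X Z p) (Y p)
     - \<omega> p (lie_bracket M Y Z p) (X p)"

definition torsion_1form ::
  "('a, 'e::euclidean_space) manifold \<Rightarrow> 'a endo_field \<Rightarrow> 'a bilin_field
    \<Rightarrow> (nat \<Rightarrow> 'a vfield) \<Rightarrow> 'a vfield \<Rightarrow> 'a \<Rightarrow> real" where
  "torsion_1form M J g e X p =
     (1/2) * (\<Sum>i=1..mdim M. ext_deriv2 M (fundamental_form J g) (e i) (app_field J (e i)) X p)"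

definition torsion_3form ::
  "('a, 'e::euclidean_space) manifold \<Rightarrow> 'a bilin_field \<Rightarrow> 'a covd
    \<Rightarrow> 'a vfield \<Rightarrow> 'a vfield \<Rightarrow> 'a vfield \<Rightarrow> 'a \<Rightarrow> real" where
  "torsion_3form M g nab X Y Z p =
     (1/3) * (g p (X p) (torsion M nab Y Z p) + g p (Z p) (torsion M nab X Y p)
            + g p (Y p) (torsion M nab Z X p))"

text \<open>The codifferential of a \<open>1\<close>-form is minus the trace of its Levi-Civita derivative \<open>D\<close>, where
  \<open>(D\<^sub>X \<alpha>)(Y) = X (\<alpha>(Y)) - \<alpha>(D\<^sub>X Y)\<close>.\<close>

definition codifferential ::
  "('a, 'e::euclidean_space) manifold \<Rightarrow> 'a covd \<Rightarrow> (nat \<Rightarrow> 'a vfield)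
    \<Rightarrow> ('a vfield \<Rightarrow> 'a \<Rightarrow> real) \<Rightarrow> 'a \<Rightarrow> real" where
  "codifferential M D e \<alpha> p =
     - (\<Sum>i=1..mdim M. e i p (\<lambda>q. \<alpha> (e i) q) - \<alpha> (cov D (e i) (e i)) p)"

definition norm_sq_1form ::
  "('a, 'e::euclidean_space) manifold \<Rightarrow> (nat \<Rightarrow> 'a vfield)
    \<Rightarrow> ('a vfield \<Rightarrow> 'a \<Rightarrow> real) \<Rightarrow> 'a \<Rightarrow> real" where
  "norm_sq_1form M e \<alpha> p = (\<Sum>i=1..mdim M. (\<alpha> (e i) p)\<^sup>2)"

definition norm_sq_3form ::
  "('a, 'e::euclidean_space) manifold \<Rightarrow> (nat \<Rightarrow> 'a vfield)
    \<Rightarrow> ('a vfield \<Rightarrow> 'a vfield \<Rightarrow> 'a vfield \<Rightarrow> 'a \<Rightarrow> real) \<Rightarrow> 'a \<Rightarrow> real" where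
  "norm_sq_3form M e \<tau> p =
     (1/6) * (\<Sum>i=1..mdim M. \<Sum>j=1..mdim M. \<Sum>k=1..mdim M. (\<tau> (e i) (e j) (e k) p)\<^sup>2)"

definition norm_sq_vector_2form ::
  "('a, 'e::euclidean_space) manifold \<Rightarrow> 'a bilin_field \<Rightarrow> (nat \<Rightarrow> 'a vfield)
    \<Rightarrow> ('a vfield \<Rightarrow> 'a vfield \<Rightarrow> 'a vfield) \<Rightarrow> 'a \<Rightarrow> real" where
  "norm_sq_vector_2form M g e T p =
     (1/2) * (\<Sum>i=1..mdim M. \<Sum>j=1..mdim M. g p (T (e i) (e j) p) (T (e i) (e j) p))"

end

theory Submission
  imports Defs
begin

text \<open>
  The identity is the contraction of the first Bianchi identity of the Chern connection
  \<open>\<nabla>\<close> with \<open>J\<close>. For a connection with torsion \<open>T\<close> this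
  identity says that the cyclic sum of \<open>R\<^bsub>XY\<^esub>Z\<close> is the cyclic sum of
  \<open>(\<nabla>\<^sub>XT)\<^bsub>YZ\<^esub> + T(T\<^bsub>XY\<^esub>, Z)\<close> (\<open>first_bianchi\<close>). Take
  \<open>X = e\<^sub>i\<close>, \<open>Y = Je\<^sub>i\<close>, \<open>Z = e\<^sub>j\<close>, pair with
  \<open>Je\<^sub>j\<close> and sum over \<open>i\<close> and \<open>j\<close>.

  On the left, the first term gives \<open>-4s\<^sup>C\<close> by definition. Since \<open>R\<close> commutes with
  \<open>J\<close> and is skew with respect to \<open>g\<close>, each of the other two becomes, after the
  frame \<open>Je\<^sub>i\<close> has been exchanged for \<open>e\<^sub>i\<close>, the contraction
  \<open>2s\<close>. On the right, the condition \<open>T\<^bsub>JX,JY\<^esub> = -T\<^bsub>XY\<^esub>\<close> is equivalent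
  to \<open>T\<^bsub>JX,Y\<^esub> = T\<^bsub>X,JY\<^esub>\<close>, so \<open>T\<^bsub>X,JX\<^esub> = 0\<close>, and it is inherited by
  \<open>\<nabla>T\<close>. Hence one derivative term vanishes, and each of the other two is the
  \<open>\<nabla>\<close>-divergence \<open>\<Sum>\<^sub>i (\<nabla>\<^bsub>e\<^sub>i\<^esub>\<theta>)(e\<^sub>i)\<close> of the trace
  \<open>\<theta>\<close> of the torsion. With \<open>T\<^bsub>ijk\<^esub> = g(T\<^bsub>e\<^sub>ie\<^sub>j\<^esub>, e\<^sub>k)\<close>,
  the quadratic terms add up to \<open>2P\<close>, where \<open>P = \<Sum> T\<^bsub>ijk\<^esub>T\<^bsub>kij\<^esub>\<close>. This
  is \<open>scalar_curvature_difference\<close>: \<open>s\<^sup>C - s\<close> is minus half the divergence minus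
  \<open>P/2\<close>.

  Two computations translate this into the stated form. The vector
  \<open>\<Sum>\<^sub>i (\<nabla>\<^bsub>e\<^sub>i\<^esub>e\<^sub>i - D\<^bsub>e\<^sub>i\<^esub>e\<^sub>i)\<close>, with
  \<open>D\<close> the Levi-Civita connection, is dual to \<open>\<theta>\<close>, so passing from
  \<open>\<nabla>\<close> to \<open>D\<close> turns the divergence into
  \<open>-\<delta>\<theta> - |\<theta>|\<^sup>2\<close> (\<open>codifferential_torsion_1form\<close>). Expanding the square of the
  cyclic sum in \<open>t\<close> gives \<open>9/2 |t|\<^sup>2 = S/4 + P/2\<close> with
  \<open>S = \<Sum> T\<^bsub>ijk\<^esub>\<^sup>2 = 2|T|\<^sup>2\<close> (\<open>torsion_norms\<close>).

  All arguments use vector fields on the domain \<open>U\<close> of the frame. Coefficients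
  \<open>g(X, e\<^sub>i)\<close> are smooth functions on \<open>U\<close>, so a tensorial operator can be
  expanded in the frame (\<open>operator_expand\<close>).
\<close>

section \<open>Smooth functions on open sets\<close>

text \<open>Openness is essential: the recursion differentiates at a point, where the derivative depends on
  the values in a full neighbourhood.\<close>

lemma Ck_on_cong:
  assumes "open S" "\<And>x. x \<in> S \<Longrightarrow> f x = h x" "Ck_on k S f"
  shows "Ck_on k S h"
  using assms
proof (induction k arbitrary: f h)
  case 0
  then show ?case using continuous_on_cong by force
next
  case (Suc k)
  have diff: "h differentiable (at x)" if "x \<in> S" for x
    using Suc.prems that by (metis Ck_on.simps(2) differentiable_def has_derivative_transform_within_open)
  have der: "frechet_derivative f (at x) = frechet_derivative h (at x)" if "x \<in> S" for x
    using Suc.prems that by (metis Ck_on.simps(2) frechet_derivative_transform_within_open)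
  have "Ck_on k S (\<lambda>x. frechet_derivative h (at x) v)" for v
    by (rule Suc.IH[of "\<lambda>x. frechet_derivative f (at x) v"]) (use Suc.prems der in auto)
  with diff show ?case by simp
qed

lemma Ck_on_subset: "Ck_on k S f \<Longrightarrow> S' \<subseteq> S \<Longrightarrow> Ck_on k S' f"
  by (induction k arbitrary: f) (auto intro: continuous_on_subset)

lemma Ck_on_Suc_imp_Ck_on: "Ck_on (Suc k) S f \<Longrightarrow> Ck_on k S f"
proof (induction k arbitrary: f)
  case 0
  then show ?case
    by (auto intro!: continuous_at_imp_continuous_on differentiable_imp_continuous_within)
qed auto

lemma Ck_on_const: "Ck_on k S (\<lambda>_. c)"
  by (induction k arbitrary: c) (auto simp: frechet_derivative_const)

lemma Ck_on_add:
  fixes f h :: "'e::euclidean_space \<Rightarrow> real"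
  assumes "open S" "Ck_on k S f" "Ck_on k S h"
  shows "Ck_on k S (\<lambda>x. f x + h x)"
  using assms(2,3)
proof (induction k arbitrary: f h)
  case 0
  then show ?case by (auto intro: continuous_on_add)
next
  case (Suc k)
  have der: "frechet_derivative (\<lambda>x. f x + h x) (at x) v
      = frechet_derivative f (at x) v + frechet_derivative h (at x) v" if "x \<in> S" for x v
  proof -
    have "(f has_derivative frechet_derivative f (at x)) (at x)"
         "(h has_derivative frechet_derivative h (at x)) (at x)"
      using Suc.prems that by (simp_all add: frechet_derivative_works[symmetric])
    from has_derivative_add[OF this] show ?thesis
      by (simp add: frechet_derivative_at[symmetric])
  qed
  have "Ck_on k S (\<lambda>x. frechet_derivative (\<lambda>x. f x + h x) (at x) v)" for v
    by (rule Ck_on_cong[OF assms(1) _ Suc.IH]) (use Suc.prems der in auto)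
  with Suc.prems show ?case by auto
qed

lemma Ck_on_mult:
  fixes f h :: "'e::euclidean_space \<Rightarrow> real"
  assumes "open S" "Ck_on k S f" "Ck_on k S h"
  shows "Ck_on k S (\<lambda>x. f x * h x)"
  using assms(2,3)
proof (induction k arbitrary: f h)
  case 0
  then show ?case by (auto intro: continuous_on_mult)
next
  case (Suc k)
  have der: "frechet_derivative (\<lambda>x. f x * h x) (at x) v
      = f x * frechet_derivative h (at x) v + frechet_derivative f (at x) v * h x" if "x \<in> S" for x v
  proof -
    have "(f has_derivative frechet_derivative f (at x)) (at x)"
         "(h has_derivative frechet_derivative h (at x)) (at x)"
      using Suc.prems that by (simp_all add: frechet_derivative_works[symmetric])
    from has_derivative_mult[OF this] show ?thesis
      by (simp add: frechet_derivative_at[symmetric])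
  qed
  have "Ck_on k S (\<lambda>x. frechet_derivative (\<lambda>x. f x * h x) (at x) v)" for v
  proof (rule Ck_on_cong[OF assms(1)])
    show "Ck_on k S (\<lambda>x. f x * frechet_derivative h (at x) v + frechet_derivative f (at x) v * h x)"
      using Suc.prems Ck_on_Suc_imp_Ck_on by (intro Ck_on_add[OF assms(1)] Suc.IH) auto
  qed (use der in auto)
  with Suc.prems show ?case by (auto intro: differentiable_mult)
qed

text \<open>The domain \<open>U\<close> of the frame is fixed. Vector fields, connections and identities are
  considered on \<open>U\<close> only, and the values elsewhere of the functions that represent them are
  arbitrary. This is why congruence lemmas for agreement on \<open>U\<close> accompany every operator.\<close>

locale manifold_region =
  fixes M :: "('a, 'e::euclidean_space) manifold" and U :: "'a set"
  assumes smooth_M: "smooth_manifold M" and open_U: "openin (mtop M) U"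
begin

lemma chart_homeo:
  assumes "(V, \<phi>) \<in> charts M"
  shows "openin (mtop M) V" "open (\<phi> ` V)"
    "homeomorphic_map (subtopology (mtop M) V) (top_of_set (\<phi> ` V)) \<phi>"
  using assms smooth_M unfolding smooth_manifold_def by blast+

lemma open_chart_image:
  assumes "(V, \<phi>) \<in> charts M" "openin (mtop M) W"
  shows "open (\<phi> ` (V \<inter> W))"
proof -
  have "openin (subtopology (mtop M) V) (V \<inter> W)"
    using assms(2) by (metis Int_commute openin_subtopology_Int2)
  then have "openin (top_of_set (\<phi> ` V)) (\<phi> ` (V \<inter> W))"
    using homeomorphic_imp_open_map[OF chart_homeo(3)[OF assms(1)]] by (simp add: open_map_def)
  then show ?thesis using chart_homeo(2)[OF assms(1)] openin_open_trans by blast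
qed

text \<open>Smoothness of \<open>f\<close> is expressed through \<open>f \<circ> inv_into V \<phi>\<close>. As a homeomorphism
  onto its image the chart is injective, so on \<open>V\<close> this is \<open>f\<close> read in the chart.\<close>

lemma chart_inv:
  assumes "(V, \<phi>) \<in> charts M" "q \<in> V"
  shows "inv_into V \<phi> (\<phi> q) = q"
proof -
  have "topspace (subtopology (mtop M) V) = V"
    using openin_subset[OF chart_homeo(1)[OF assms(1)]] by auto
  then have "inj_on \<phi> V"
    using homeomorphic_imp_injective_map[OF chart_homeo(3)[OF assms(1)]] by simp
  then show ?thesis using assms(2) by simp
qed

lemma smooth_fun_cong:
  assumes "openin (mtop M) W" "smooth_fun M W f" "\<And>q. q \<in> W \<Longrightarrow> f q = h q"
  shows "smooth_fun M W h"
  unfolding smooth_fun_def Cinf_on_def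
proof clarify
  fix V \<phi> k assume ch: "(V, \<phi>) \<in> charts M"
  show "Ck_on k (\<phi> ` (V \<inter> W)) (h \<circ> inv_into V \<phi>)"
    by (rule Ck_on_cong[OF open_chart_image[OF ch assms(1)], of "f \<circ> inv_into V \<phi>"])
      (use assms ch chart_inv[OF ch] in \<open>auto simp: smooth_fun_def Cinf_on_def\<close>)
qed

lemma smooth_fun_subset:
  assumes "smooth_fun M W f" "W' \<subseteq> W"
  shows "smooth_fun M W' f"
  unfolding smooth_fun_def Cinf_on_def
proof clarify
  fix V \<phi> k assume ch: "(V, \<phi>) \<in> charts M"
  show "Ck_on k (\<phi> ` (V \<inter> W')) (f \<circ> inv_into V \<phi>)"
    by (rule Ck_on_subset[of _ "\<phi> ` (V \<inter> W)"])
      (use assms ch in \<open>auto simp: smooth_fun_def Cinf_on_def\<close>)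
qed

lemma smooth_fun_const: "smooth_fun M W (\<lambda>_. c)"
  by (auto simp: smooth_fun_def Cinf_on_def comp_def Ck_on_const)

lemma smooth_fun_add:
  assumes "openin (mtop M) W" "smooth_fun M W f" "smooth_fun M W h"
  shows "smooth_fun M W (\<lambda>q. f q + h q)"
  unfolding smooth_fun_def Cinf_on_def
proof clarify
  fix V \<phi> k assume ch: "(V, \<phi>) \<in> charts M"
  then have "Ck_on k (\<phi> ` (V \<inter> W)) (f \<circ> inv_into V \<phi>)" "Ck_on k (\<phi> ` (V \<inter> W)) (h \<circ> inv_into V \<phi>)"
    using assms by (auto simp: smooth_fun_def Cinf_on_def)
  from Ck_on_add[OF open_chart_image[OF ch assms(1)] this]
  show "Ck_on k (\<phi> ` (V \<inter> W)) ((\<lambda>q. f q + h q) \<circ> inv_into V \<phi>)"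
    by (simp add: comp_def)
qed

lemma smooth_fun_mult:
  assumes "openin (mtop M) W" "smooth_fun M W f" "smooth_fun M W h"
  shows "smooth_fun M W (\<lambda>q. f q * h q)"
  unfolding smooth_fun_def Cinf_on_def
proof clarify
  fix V \<phi> k assume ch: "(V, \<phi>) \<in> charts M"
  then have "Ck_on k (\<phi> ` (V \<inter> W)) (f \<circ> inv_into V \<phi>)" "Ck_on k (\<phi> ` (V \<inter> W)) (h \<circ> inv_into V \<phi>)"
    using assms by (auto simp: smooth_fun_def Cinf_on_def)
  from Ck_on_mult[OF open_chart_image[OF ch assms(1)] this]
  show "Ck_on k (\<phi> ` (V \<inter> W)) ((\<lambda>q. f q * h q) \<circ> inv_into V \<phi>)"
    by (simp add: comp_def)
qed

lemma smooth_fun_diff: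
  assumes "openin (mtop M) W" "smooth_fun M W f" "smooth_fun M W h"
  shows "smooth_fun M W (\<lambda>q. f q - h q)"
  using smooth_fun_add[OF assms(1,2) smooth_fun_mult[OF assms(1) smooth_fun_const assms(3), of "-1"]]
  by simp

lemma smooth_fun_sum:
  assumes "openin (mtop M) W" "finite A" "\<And>i. i \<in> A \<Longrightarrow> smooth_fun M W (f i)"
  shows "smooth_fun M W (\<lambda>q. \<Sum>i\<in>A. f i q)"
  using assms(2,3)
  by (induction A rule: finite_induct) (auto intro: smooth_fun_const smooth_fun_add[OF assms(1)])

lemma smooth_near_cong:
  assumes "smooth_near M p f" "openin (mtop M) W" "p \<in> W" "\<And>q. q \<in> W \<Longrightarrow> f q = h q"
  shows "smooth_near M p h"
proof -
  obtain W' where W': "openin (mtop M) W'" "p \<in> W'" "smooth_fun M W' f"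
    using assms(1) unfolding smooth_near_def by blast
  have op: "openin (mtop M) (W \<inter> W')" using assms W' by auto
  have "smooth_fun M (W \<inter> W') h"
    by (rule smooth_fun_cong[OF op smooth_fun_subset[OF W'(3)]]) (use assms in auto)
  with op assms(3) W'(2) show ?thesis unfolding smooth_near_def by blast
qed

lemma smooth_near_common:
  assumes "smooth_near M p f" "smooth_near M p h" "p \<in> U"
  obtains W where "openin (mtop M) W" "p \<in> W" "W \<subseteq> U" "smooth_fun M W f" "smooth_fun M W h"
proof -
  obtain W1 W2 where "openin (mtop M) W1" "p \<in> W1" "smooth_fun M W1 f"
    "openin (mtop M) W2" "p \<in> W2" "smooth_fun M W2 h"
    using assms unfolding smooth_near_def by blast
  then show ?thesis
    using that[of "W1 \<inter> W2 \<inter> U"] open_U assms(3) smooth_fun_subset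
    by (metis Int_iff inf_le1 inf_le2 inf_assoc openin_Int le_infI1)
qed

lemma smooth_near_add:
  "smooth_near M p f \<Longrightarrow> smooth_near M p h \<Longrightarrow> p \<in> U \<Longrightarrow> smooth_near M p (\<lambda>q. f q + h q)"
  by (erule (2) smooth_near_common) (auto simp: smooth_near_def intro: smooth_fun_add)

lemma smooth_near_diff:
  "smooth_near M p f \<Longrightarrow> smooth_near M p h \<Longrightarrow> p \<in> U \<Longrightarrow> smooth_near M p (\<lambda>q. f q - h q)"
  by (erule (2) smooth_near_common) (auto simp: smooth_near_def intro: smooth_fun_diff)

lemma smooth_near_mult:
  "smooth_near M p f \<Longrightarrow> smooth_near M p h \<Longrightarrow> p \<in> U \<Longrightarrow> smooth_near M p (\<lambda>q. f q * h q)"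
  by (erule (2) smooth_near_common) (auto simp: smooth_near_def intro: smooth_fun_mult)

lemma smooth_near_const: "p \<in> U \<Longrightarrow> smooth_near M p (\<lambda>_. c)"
  using open_U smooth_fun_const unfolding smooth_near_def by blast

lemma smooth_near_if_smooth_fun: "smooth_fun M U f \<Longrightarrow> p \<in> U \<Longrightarrow> smooth_near M p f"
  using open_U unfolding smooth_near_def by blast

end

section \<open>Tangent vectors and the Lie bracket\<close>

lemma tangent_add_fun:
  "v \<in> tangent_space M p \<Longrightarrow> smooth_near M p f \<Longrightarrow> smooth_near M p h \<Longrightarrow>
    v (\<lambda>q. f q + h q) = v f + v h"
  by (simp add: tangent_space_def)

lemma tangent_mult_fun:
  "v \<in> tangent_space M p \<Longrightarrow> smooth_near M p f \<Longrightarrow> smooth_near M p h \<Longrightarrow>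
    v (\<lambda>q. f q * h q) = f p * v h + h p * v f"
  by (simp add: tangent_space_def)

lemma tangent_scale_fun:
  "v \<in> tangent_space M p \<Longrightarrow> smooth_near M p f \<Longrightarrow> v (\<lambda>q. c * f q) = c * v f"
  by (simp add: tangent_space_def)

lemma tangent_germ:
  assumes "v \<in> tangent_space M p" "openin (mtop M) W" "p \<in> W" "\<And>q. q \<in> W \<Longrightarrow> f q = h q"
  shows "v f = v h"
proof -
  have "\<forall>f h W. openin (mtop M) W \<longrightarrow> p \<in> W \<longrightarrow> (\<forall>q\<in>W. f q = h q) \<longrightarrow> v f = v h"
    using assms(1) by (simp add: tangent_space_def)
  then show ?thesis using assms(2-4) by blast
qed

lemma tangent_not_smooth: "v \<in> tangent_space M p \<Longrightarrow> \<not> smooth_near M p f \<Longrightarrow> v f = 0"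
  by (simp add: tangent_space_def)

lemma tangentI:
  assumes "\<And>f h. smooth_near M p f \<Longrightarrow> smooth_near M p h \<Longrightarrow> v (\<lambda>q. f q + h q) = v f + v h"
    "\<And>f h. smooth_near M p f \<Longrightarrow> smooth_near M p h \<Longrightarrow> v (\<lambda>q. f q * h q) = f p * v h + h p * v f"
    "\<And>c f. smooth_near M p f \<Longrightarrow> v (\<lambda>q. c * f q) = c * v f"
    "\<And>f h W. openin (mtop M) W \<Longrightarrow> p \<in> W \<Longrightarrow> (\<And>q. q \<in> W \<Longrightarrow> f q = h q) \<Longrightarrow> v f = v h"
    "\<And>f. \<not> smooth_near M p f \<Longrightarrow> v f = 0"
  shows "v \<in> tangent_space M p"
  unfolding tangent_space_def mem_Collect_eq
proof (intro conjI allI impI)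
  fix f h :: "_ \<Rightarrow> real" and W assume "openin (mtop M) W" "p \<in> W" "\<forall>q\<in>W. f q = h q"
  then show "v f = v h" by (intro assms(4)) auto
qed (simp_all add: assms(1,2,3,5))

lemma tangent_add:
  assumes "v \<in> tangent_space M p" "w \<in> tangent_space M p"
  shows "v + w \<in> tangent_space M p"
proof (rule tangentI)
  fix f h :: "_ \<Rightarrow> real" and W
    assume W: "openin (mtop M) W" "p \<in> W" "\<And>q. q \<in> W \<Longrightarrow> f q = h q"
  then show "(v + w) f = (v + w) h"
    using tangent_germ[OF assms(1) W] tangent_germ[OF assms(2) W] by simp
qed (use assms in \<open>simp_all add: tangent_add_fun tangent_mult_fun tangent_scale_fun
      tangent_not_smooth algebra_simps\<close>)

lemma tangent_scale:
  assumes "v \<in> tangent_space M p"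
  shows "c *\<^sub>T v \<in> tangent_space M p"
proof (rule tangentI)
  fix f h :: "_ \<Rightarrow> real" and W
    assume W: "openin (mtop M) W" "p \<in> W" "\<And>q. q \<in> W \<Longrightarrow> f q = h q"
  then show "c * v f = c * v h"
    using tangent_germ[OF assms(1) W] by simp
qed (use assms in \<open>simp_all add: tangent_add_fun tangent_mult_fun tangent_scale_fun
      tangent_not_smooth algebra_simps\<close>)

lemma tangent_uminus: "v \<in> tangent_space M p \<Longrightarrow> - v \<in> tangent_space M p"
  using tangent_scale[of v M p "-1"] by (simp add: fun_Compl_def)

lemma tangent_diff: "v \<in> tangent_space M p \<Longrightarrow> w \<in> tangent_space M p \<Longrightarrow> v - w \<in> tangent_space M p"
  using tangent_add[OF _ tangent_uminus, of v M p w] by simp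

lemma tangent_zero: "0 \<in> tangent_space M p"
  by (simp add: tangent_space_def)

lemma tangent_sum:
  "finite A \<Longrightarrow> (\<And>i. i \<in> A \<Longrightarrow> v i \<in> tangent_space M p) \<Longrightarrow> (\<Sum>i\<in>A. v i) \<in> tangent_space M p"
  by (induction A rule: finite_induct) (auto intro: tangent_add tangent_zero)

lemma self_negative_tangent: "(v :: 'a tangent) = - v \<Longrightarrow> v = 0"
  by (auto simp: fun_eq_iff)

context manifold_region
begin

abbreviation VF where "VF \<equiv> vector_fields M U"

lemma tangent_diff_fun:
  assumes "v \<in> tangent_space M p" "smooth_near M p f" "smooth_near M p h" "p \<in> U"
  shows "v (\<lambda>q. f q - h q) = v f - v h"
  using tangent_add_fun[OF assms(1) smooth_near_diff[OF assms(2-4)] assms(3)] by simp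

lemma tangent_const_fun:
  assumes "v \<in> tangent_space M p" "p \<in> U"
  shows "v (\<lambda>_. c) = 0"
proof -
  have "v (\<lambda>_. 1) = 0"
    using tangent_mult_fun[OF assms(1) smooth_near_const smooth_near_const, of 1 1] assms(2) by simp
  then show ?thesis
    using tangent_scale_fun[OF assms(1) smooth_near_const[OF assms(2)], of c 1] by simp
qed

lemma tangent_sum_fun:
  assumes "v \<in> tangent_space M p" "p \<in> U" "finite A" "\<And>i. i \<in> A \<Longrightarrow> smooth_fun M U (f i)"
  shows "v (\<lambda>q. \<Sum>i\<in>A. f i q) = (\<Sum>i\<in>A. v (f i))"
  using assms(3,4)
proof (induction A rule: finite_induct)
  case empty
  show ?case using tangent_const_fun[OF assms(1,2)] by simp
next
  case (insert a A)
  have "smooth_near M p (f a)" "smooth_near M p (\<lambda>q. \<Sum>i\<in>A. f i q)"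
    using insert smooth_fun_sum[OF open_U] by (auto intro!: smooth_near_if_smooth_fun[OF _ assms(2)])
  from tangent_add_fun[OF assms(1) this] insert show ?case by simp
qed

lemma vf_tangent [simp]: "X \<in> VF \<Longrightarrow> q \<in> U \<Longrightarrow> X q \<in> tangent_space M q"
  by (simp add: vector_fields_def)

lemma vf_smooth:
  "X \<in> VF \<Longrightarrow> openin (mtop M) W \<Longrightarrow> W \<subseteq> U \<Longrightarrow> smooth_fun M W f \<Longrightarrow> smooth_fun M W (\<lambda>q. X q f)"
  unfolding vector_fields_def by blast

lemma vfI:
  assumes "\<And>q. q \<in> U \<Longrightarrow> X q \<in> tangent_space M q"
    "\<And>W f. openin (mtop M) W \<Longrightarrow> W \<subseteq> U \<Longrightarrow> smooth_fun M W f \<Longrightarrow> smooth_fun M W (\<lambda>q. X q f)"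
  shows "X \<in> VF"
  unfolding vector_fields_def mem_Collect_eq using assms by (intro conjI ballI allI impI)

lemma vf_near:
  assumes "X \<in> VF" "q \<in> U" "smooth_near M q f"
  shows "smooth_near M q (\<lambda>r. X r f)"
proof -
  obtain W where "openin (mtop M) W" "q \<in> W" "W \<subseteq> U" "smooth_fun M W f"
    using smooth_near_common[OF assms(3) assms(3) assms(2)] by blast
  with vf_smooth[OF assms(1)] show ?thesis unfolding smooth_near_def by blast
qed

lemma vf_add: "X \<in> VF \<Longrightarrow> Y \<in> VF \<Longrightarrow> X + Y \<in> VF"
  by (rule vfI) (auto simp: tangent_add intro: smooth_fun_add vf_smooth)

lemma vf_scale: "X \<in> VF \<Longrightarrow> smooth_fun M U f \<Longrightarrow> (\<lambda>q. f q *\<^sub>T X q) \<in> VF"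
  by (rule vfI) (auto simp: tangent_scale intro: smooth_fun_mult vf_smooth smooth_fun_subset)

lemma uminus_vf_eq: "(- X :: 'a vfield) = (\<lambda>q. (-1) *\<^sub>T X q)"
  by (auto simp: fun_Compl_def)

lemma vf_uminus: "X \<in> VF \<Longrightarrow> - X \<in> VF"
  using vf_scale[of X "\<lambda>_. -1"] smooth_fun_const by (simp add: uminus_vf_eq)

lemma vf_diff: "X \<in> VF \<Longrightarrow> Y \<in> VF \<Longrightarrow> X - Y \<in> VF"
  using vf_add[of X "- Y"] vf_uminus by simp

lemma vf_zero: "0 \<in> VF"
  by (rule vfI) (auto simp: tangent_zero smooth_fun_const)

lemma vf_sum: "finite A \<Longrightarrow> (\<And>i. i \<in> A \<Longrightarrow> X i \<in> VF) \<Longrightarrow> (\<Sum>i\<in>A. X i) \<in> VF"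
  by (induction A rule: finite_induct) (auto simp: vf_zero vf_add)

text \<open>In the product rule for \<open>XY - YX\<close> the mixed terms \<open>Xf \<cdot> Yh\<close> and
  \<open>Yf \<cdot> Xh\<close> are symmetric in \<open>X\<close> and \<open>Y\<close> and cancel.\<close>

lemma lie_bracket_in_tangent_space:
  assumes X: "X \<in> VF" and Y: "Y \<in> VF" and p: "p \<in> U"
  shows "lie_bracket M X Y p \<in> tangent_space M p"
proof -
  note Xp = vf_tangent[OF X p] and Yp = vf_tangent[OF Y p]
  have add: "A p (\<lambda>q. B q (\<lambda>q. f q + h q)) = A p (\<lambda>q. B q f) + A p (\<lambda>q. B q h)"
    and mult: "A p (\<lambda>q. B q (\<lambda>q. f q * h q))
      = f p * A p (\<lambda>q. B q h) + B p h * A p f + (h p * A p (\<lambda>q. B q f) + B p f * A p h)"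
    if A: "A \<in> VF" and B: "B \<in> VF" and sm: "smooth_near M p f" "smooth_near M p h" for A B f h
  proof -
    note near = sm vf_near[OF B p sm(1)] vf_near[OF B p sm(2)]
    note Ap = vf_tangent[OF A p]
    obtain W where W: "openin (mtop M) W" "p \<in> W" "W \<subseteq> U" "smooth_fun M W f" "smooth_fun M W h"
      using smooth_near_common[OF sm p] by blast
    have at: "B q \<in> tangent_space M q" "smooth_near M q f" "smooth_near M q h" if "q \<in> W" for q
      using that W B unfolding smooth_near_def by auto
    have "A p (\<lambda>q. B q (\<lambda>q. f q + h q)) = A p (\<lambda>q. B q f + B q h)"
      by (rule tangent_germ[OF Ap W(1,2)]) (rule tangent_add_fun[OF at])
    then show "A p (\<lambda>q. B q (\<lambda>q. f q + h q)) = A p (\<lambda>q. B q f) + A p (\<lambda>q. B q h)"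
      using tangent_add_fun[OF Ap] near by simp
    have "A p (\<lambda>q. B q (\<lambda>q. f q * h q)) = A p (\<lambda>q. f q * B q h + h q * B q f)"
      by (rule tangent_germ[OF Ap W(1,2)]) (rule tangent_mult_fun[OF at])
    then show "A p (\<lambda>q. B q (\<lambda>q. f q * h q))
      = f p * A p (\<lambda>q. B q h) + B p h * A p f + (h p * A p (\<lambda>q. B q f) + B p f * A p h)"
      using tangent_add_fun[OF Ap] tangent_mult_fun[OF Ap] smooth_near_mult near p by simp
  qed
  \<comment> \<open>Multiplication by a constant is the product rule with a factor whose derivatives vanish.\<close>
  have scale: "A p (\<lambda>q. B q (\<lambda>q. c * f q)) = c * A p (\<lambda>q. B q f)"
    if A: "A \<in> VF" and B: "B \<in> VF" and sm: "smooth_near M p f" for A B f c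
  proof -
    have B0: "B q (\<lambda>_. c) = 0" if "q \<in> U" for q
      using tangent_const_fun[OF vf_tangent[OF B that] that] .
    have A0: "A p (\<lambda>_. c) = 0" for c
      using tangent_const_fun[OF vf_tangent[OF A p] p] .
    have "A p (\<lambda>q. B q (\<lambda>_. c)) = A p (\<lambda>_. 0)"
      by (rule tangent_germ[OF vf_tangent[OF A p] open_U p B0])
    with mult[OF A B smooth_near_const[OF p, of c] sm] B0[OF p] A0 show ?thesis by simp
  qed
  have germ: "lie_bracket M X Y p f = lie_bracket M X Y p h"
    if W: "openin (mtop M) W" "p \<in> W" "\<forall>q\<in>W. f q = h q" for f h W
  proof -
    have eq: "smooth_near M p f \<longleftrightarrow> smooth_near M p h"
      using smooth_near_cong[OF _ W(1,2)] W(3) by metis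
    have WU: "openin (mtop M) (W \<inter> U)" "p \<in> W \<inter> U" using W p open_U by auto
    have "A p (\<lambda>q. B q f) = A p (\<lambda>q. B q h)" if A: "A \<in> VF" and B: "B \<in> VF" for A B
    proof (rule tangent_germ[OF vf_tangent[OF A p] WU])
      fix q assume q: "q \<in> W \<inter> U"
      show "B q f = B q h"
        by (rule tangent_germ[OF vf_tangent[OF B] W(1)]) (use q W(3) in auto)
    qed
    from this[OF X Y] this[OF Y X] eq show ?thesis by (simp add: lie_bracket_def)
  qed
  show ?thesis
  proof (rule tangentI)
    fix f h :: "_ \<Rightarrow> real" and W
    assume W: "openin (mtop M) W" "p \<in> W" "\<And>q. q \<in> W \<Longrightarrow> f q = h q"
    then show "lie_bracket M X Y p f = lie_bracket M X Y p h" using germ by blast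
  qed (use add[OF X Y] add[OF Y X] mult[OF X Y] mult[OF Y X] scale[OF X Y] scale[OF Y X] p
      smooth_near_mult[OF smooth_near_const] in
      \<open>simp_all add: lie_bracket_def smooth_near_add smooth_near_mult algebra_simps\<close>)
qed

lemma vf_lie_bracket:
  assumes X: "X \<in> VF" and Y: "Y \<in> VF"
  shows "lie_bracket M X Y \<in> VF"
proof (rule vfI)
  fix W f assume W: "openin (mtop M) W" "W \<subseteq> U" "smooth_fun M W f"
  have near: "smooth_near M q f" if "q \<in> W" for q
    using W that unfolding smooth_near_def by blast
  have "smooth_fun M W (\<lambda>q. X q (\<lambda>q. Y q f) - Y q (\<lambda>q. X q f))"
    by (rule smooth_fun_diff[OF W(1) vf_smooth[OF X W(1,2) vf_smooth[OF Y W]]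
          vf_smooth[OF Y W(1,2) vf_smooth[OF X W]]])
  then show "smooth_fun M W (\<lambda>q. lie_bracket M X Y q f)"
    by (rule smooth_fun_cong[OF W(1)]) (simp add: near lie_bracket_def)
qed (rule lie_bracket_in_tangent_space[OF X Y])

lemma lie_bracket_antisym: "lie_bracket M X Y = - lie_bracket M Y X"
  by (auto simp: lie_bracket_def fun_eq_iff)

lemma lie_bracket_cong:
  assumes "X \<in> VF" "Y \<in> VF" "p \<in> U"
    "\<And>q. q \<in> U \<Longrightarrow> X q = X' q" "\<And>q. q \<in> U \<Longrightarrow> Y q = Y' q"
  shows "lie_bracket M X Y p = lie_bracket M X' Y' p"
proof
  fix f
  have "A p (\<lambda>q. B q f) = A p (\<lambda>q. B' q f)"
    if "A \<in> VF" "\<And>q. q \<in> U \<Longrightarrow> B q = B' q" for A B and B' :: "'a vfield"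
    by (rule tangent_germ[OF vf_tangent[OF that(1) assms(3)] open_U assms(3)]) (simp add: that(2))
  from this[of X Y Y'] this[of Y X X']
show "lie_bracket M X Y p f = lie_bracket M X' Y' p f"
    using assms by (simp add: lie_bracket_def)
qed

lemma lie_bracket_add_right:
  assumes "X \<in> VF" "Y \<in> VF" "Z \<in> VF" "p \<in> U"
  shows "lie_bracket M X (Y + Z) p = lie_bracket M X Y p + lie_bracket M X Z p"
proof
  fix f
  show "lie_bracket M X (Y + Z) p f = (lie_bracket M X Y p + lie_bracket M X Z p) f"
    using tangent_add_fun[OF vf_tangent[OF assms(1,4)] vf_near[OF assms(2,4)] vf_near[OF assms(3,4)]]
    by (simp add: lie_bracket_def)
qed

lemma lie_bracket_scale_right:
  assumes "X \<in> VF" "Y \<in> VF" "smooth_fun M U f" "p \<in> U"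
  shows "lie_bracket M X (\<lambda>q. f q *\<^sub>T Y q) p = X p f *\<^sub>T Y p + f p *\<^sub>T lie_bracket M X Y p"
proof
  fix h
  show "lie_bracket M X (\<lambda>q. f q *\<^sub>T Y q) p h = (X p f *\<^sub>T Y p + f p *\<^sub>T lie_bracket M X Y p) h"
  proof (cases "smooth_near M p h")
    case True
    then have "X p (\<lambda>q. f q * Y q h) = f p * X p (\<lambda>q. Y q h) + Y p h * X p f"
      using assms by (intro tangent_mult_fun) (auto intro: vf_near smooth_near_if_smooth_fun)
    then show ?thesis using True by (simp add: lie_bracket_def algebra_simps)
  next
    case False
    then show ?thesis using tangent_not_smooth[OF vf_tangent[OF assms(2,4)]] by (simp add: lie_bracket_def)
  qed
qed

lemma lie_bracket_uminus_left:
  assumes "X \<in> VF" "Y \<in> VF" "p \<in> U"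
  shows "lie_bracket M (- X) Y p = - lie_bracket M X Y p"
proof -
  have "lie_bracket M Y (- X) p = - lie_bracket M Y X p"
    using lie_bracket_scale_right[OF assms(2,1) smooth_fun_const assms(3), of "-1"]
      tangent_const_fun[OF vf_tangent[OF assms(2,3)] assms(3)]
    by (simp add: fun_Compl_def fun_eq_iff)
  then show ?thesis
    by (simp add: lie_bracket_antisym[of "- X" Y] lie_bracket_antisym[of X Y])
qed

lemma jacobi_identity:
  assumes X: "X \<in> VF" and Y: "Y \<in> VF" and Z: "Z \<in> VF" and p: "p \<in> U"
  shows "lie_bracket M X (lie_bracket M Y Z) p + lie_bracket M Y (lie_bracket M Z X) p
    + lie_bracket M Z (lie_bracket M X Y) p = 0"
proof
  fix f
  show "(lie_bracket M X (lie_bracket M Y Z) p + lie_bracket M Y (lie_bracket M Z X) p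
    + lie_bracket M Z (lie_bracket M X Y) p) f = 0 f"
  proof (cases "smooth_near M p f")
    case True
    have expand: "lie_bracket M A (lie_bracket M B C) p f
        = A p (\<lambda>q. B q (\<lambda>q. C q f)) - A p (\<lambda>q. C q (\<lambda>q. B q f))
        - (B p (\<lambda>q. C q (\<lambda>q. A q f)) - C p (\<lambda>q. B q (\<lambda>q. A q f)))"
      if A: "A \<in> VF" and B: "B \<in> VF" and C: "C \<in> VF" for A B C
    proof -
      obtain W where W: "openin (mtop M) W" "p \<in> W" "W \<subseteq> U" "smooth_fun M W f"
        using smooth_near_common[OF True True p] by blast
      have "A p (\<lambda>q. lie_bracket M B C q f)
          = A p (\<lambda>q. B q (\<lambda>q. C q f) - C q (\<lambda>q. B q f))"
        by (rule tangent_germ[OF vf_tangent[OF A p] W(1,2)])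
          (use W in \<open>auto simp: lie_bracket_def smooth_near_def\<close>)
      also have "\<dots> = A p (\<lambda>q. B q (\<lambda>q. C q f)) - A p (\<lambda>q. C q (\<lambda>q. B q f))"
        using tangent_diff_fun[OF vf_tangent[OF A p]] vf_near True p B C by simp
      finally show ?thesis using True vf_near[OF A p True] by (simp add: lie_bracket_def)
    qed
    show ?thesis using expand[OF X Y Z] expand[OF Y Z X] expand[OF Z X Y] by simp
  qed (simp add: lie_bracket_def)
qed

end

section \<open>Torsion and the first Bianchi identity\<close>

text \<open>The covariant derivative \<open>(\<nabla>\<^sub>XT)(Y,Z)\<close> of the torsion.\<close>

definition cov_torsion ::
  "('a, 'e::euclidean_space) manifold \<Rightarrow> 'a covd \<Rightarrow> 'a vfield \<Rightarrow> 'a vfield \<Rightarrow> 'a vfield \<Rightarrow> 'a vfield" where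
  "cov_torsion M nab X Y Z =
     cov nab X (torsion M nab Y Z) - torsion M nab (cov nab X Y) Z - torsion M nab Y (cov nab X Z)"

locale connection_region = manifold_region M U
  for M :: "('a, 'e::euclidean_space) manifold" and U +
  fixes nab :: "'a covd"
  assumes conn: "connection M nab"
begin

lemma conn_rules:
  assumes "Y \<in> VF" "p \<in> U" "v \<in> tangent_space M p"
  shows nab_add_dir: "w \<in> tangent_space M p \<Longrightarrow> nab p (v + w) Y = nab p v Y + nab p w Y"
    and nab_scale_dir: "nab p (c *\<^sub>T v) Y = c *\<^sub>T nab p v Y"
    and nab_add: "Z \<in> VF \<Longrightarrow> nab p v (Y + Z) = nab p v Y + nab p v Z"
    and nab_leibniz: "smooth_fun M U f \<Longrightarrow>
      nab p v (\<lambda>q. f q *\<^sub>T Y q) = v f *\<^sub>T Y p + f p *\<^sub>T nab p v Y"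
    and nab_cong: "(\<And>q. q \<in> U \<Longrightarrow> Z q = Y q) \<Longrightarrow> nab p v Z = nab p v Y"
proof -
  have "\<forall>p\<in>U. \<forall>v\<in>tangent_space M p.
      nab p v Y \<in> tangent_space M p \<and>
      (\<forall>w\<in>tangent_space M p. nab p (v + w) Y = nab p v Y + nab p w Y) \<and>
      (\<forall>c. nab p (c *\<^sub>T v) Y = c *\<^sub>T nab p v Y) \<and>
      (\<forall>Z\<in>VF. nab p v (Y + Z) = nab p v Y + nab p v Z) \<and>
      (\<forall>f. smooth_fun M U f \<longrightarrow>
         nab p v (\<lambda>q. f q *\<^sub>T Y q) = v f *\<^sub>T Y p + f p *\<^sub>T nab p v Y) \<and>
      (\<forall>Z. (\<forall>q\<in>U. Z q = Y q) \<longrightarrow> nab p v Z = nab p v Y)"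
    by (rule conn[unfolded connection_def, rule_format, OF open_U assms(1), THEN conjunct1])
  note at = bspec[OF bspec[OF this assms(2)] assms(3)]
  show "nab p (v + w) Y = nab p v Y + nab p w Y" if "w \<in> tangent_space M p"
    by (rule at[THEN conjunct2, THEN conjunct1, rule_format, OF that])
  show "nab p (c *\<^sub>T v) Y = c *\<^sub>T nab p v Y"
    by (rule at[THEN conjunct2, THEN conjunct2, THEN conjunct1, rule_format])
  show "nab p v (Y + Z) = nab p v Y + nab p v Z" if "Z \<in> VF"
    by (rule at[THEN conjunct2, THEN conjunct2, THEN conjunct2, THEN conjunct1, rule_format, OF that])
  show "nab p v (\<lambda>q. f q *\<^sub>T Y q) = v f *\<^sub>T Y p + f p *\<^sub>T nab p v Y" if "smooth_fun M U f"
    by (rule at[THEN conjunct2, THEN conjunct2, THEN conjunct2, THEN conjunct2, THEN conjunct1, rule_format, OF that])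
  show "nab p v Z = nab p v Y" if "\<And>q. q \<in> U \<Longrightarrow> Z q = Y q"
    by (rule at[THEN conjunct2, THEN conjunct2, THEN conjunct2, THEN conjunct2, THEN conjunct2, rule_format, OF that])
qed

lemma vf_cov: "X \<in> VF \<Longrightarrow> Y \<in> VF \<Longrightarrow> cov nab X Y \<in> VF"
  by (rule conn[unfolded connection_def, rule_format, OF open_U, THEN conjunct2, rule_format])

lemma cov_add_left:
  "X \<in> VF \<Longrightarrow> X' \<in> VF \<Longrightarrow> Y \<in> VF \<Longrightarrow> p \<in> U \<Longrightarrow> cov nab (X + X') Y p = cov nab X Y p + cov nab X' Y p"
  using nab_add_dir[OF _ _ vf_tangent vf_tangent] by (simp add: cov_def)

lemma cov_scale_left:
  "X \<in> VF \<Longrightarrow> Y \<in> VF \<Longrightarrow> p \<in> U \<Longrightarrow> cov nab (\<lambda>q. f q *\<^sub>T X q) Y p = f p *\<^sub>T cov nab X Y p"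
  using nab_scale_dir[OF _ _ vf_tangent] by (simp add: cov_def)

lemma cov_uminus_left:
  "X \<in> VF \<Longrightarrow> Y \<in> VF \<Longrightarrow> p \<in> U \<Longrightarrow> cov nab (- X) Y p = - cov nab X Y p"
  using cov_scale_left[of X Y p "\<lambda>_. -1"] by (simp add: fun_Compl_def)

lemma cov_add_right:
  "X \<in> VF \<Longrightarrow> Y \<in> VF \<Longrightarrow> Z \<in> VF \<Longrightarrow> p \<in> U \<Longrightarrow> cov nab X (Y + Z) p = cov nab X Y p + cov nab X Z p"
  using nab_add[OF _ _ vf_tangent] by (simp add: cov_def)

lemma cov_leibniz:
  "X \<in> VF \<Longrightarrow> Y \<in> VF \<Longrightarrow> smooth_fun M U f \<Longrightarrow> p \<in> U \<Longrightarrow>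
    cov nab X (\<lambda>q. f q *\<^sub>T Y q) p = X p f *\<^sub>T Y p + f p *\<^sub>T cov nab X Y p"
  using nab_leibniz[OF _ _ vf_tangent] by (simp add: cov_def)

lemma cov_uminus_right:
  assumes "X \<in> VF" "Y \<in> VF" "p \<in> U"
  shows "cov nab X (- Y) p = - cov nab X Y p"
  using cov_leibniz[OF assms(1,2) smooth_fun_const assms(3), of "-1"]
    tangent_const_fun[OF vf_tangent[OF assms(1,3)] assms(3)]
  by (simp add: fun_Compl_def fun_eq_iff)

lemma cov_diff_right:
  "X \<in> VF \<Longrightarrow> Y \<in> VF \<Longrightarrow> Z \<in> VF \<Longrightarrow> p \<in> U \<Longrightarrow> cov nab X (Y - Z) p = cov nab X Y p - cov nab X Z p"
  using cov_add_right[of X Y "- Z" p] cov_uminus_right[of X Z p] vf_uminus[of Z] by simp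

lemma cov_cong:
  assumes "X \<in> VF" "Y \<in> VF" "p \<in> U" "X p = X' p" "\<And>q. q \<in> U \<Longrightarrow> Y q = Y' q"
  shows "cov nab X Y p = cov nab X' Y' p"
  using nab_cong[OF assms(2,3) vf_tangent[OF assms(1,3)], of Y'] assms(4,5) by (simp add: cov_def)

lemma vf_torsion: "X \<in> VF \<Longrightarrow> Y \<in> VF \<Longrightarrow> torsion M nab X Y \<in> VF"
  by (simp add: torsion_def vf_diff vf_cov vf_lie_bracket)

lemma torsion_antisym: "torsion M nab X Y p = - torsion M nab Y X p"
  using lie_bracket_antisym[of X Y] by (simp add: torsion_def)

lemma torsion_add_right:
  assumes "X \<in> VF" "Y \<in> VF" "Z \<in> VF" "p \<in> U"
  shows "torsion M nab X (Y + Z) p = torsion M nab X Y p + torsion M nab X Z p"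
  using cov_add_right[OF assms] cov_add_left[OF assms(2,3,1,4)] lie_bracket_add_right[OF assms]
  by (simp add: torsion_def)

text \<open>The derivative \<open>Xf \<cdot> Y\<close> from the Leibniz rule of the connection cancels the one in
  \<open>[X, fY]\<close>; this is what makes the torsion a tensor.\<close>

lemma torsion_scale_right:
  assumes "X \<in> VF" "Y \<in> VF" "smooth_fun M U f" "p \<in> U"
  shows "torsion M nab X (\<lambda>q. f q *\<^sub>T Y q) p = f p *\<^sub>T torsion M nab X Y p"
  using cov_leibniz[OF assms] cov_scale_left[OF assms(2,1,4), of f] lie_bracket_scale_right[OF assms]
  by (simp add: torsion_def fun_eq_iff algebra_simps)

lemma torsion_cong:
  assumes "X \<in> VF" "Y \<in> VF" "p \<in> U"
    "\<And>q. q \<in> U \<Longrightarrow> X q = X' q" "\<And>q. q \<in> U \<Longrightarrow> Y q = Y' q"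
  shows "torsion M nab X Y p = torsion M nab X' Y' p"
proof -
  have "cov nab X Y p = cov nab X' Y' p" "cov nab Y X p = cov nab Y' X' p"
    using assms by (auto intro!: cov_cong)
  with lie_bracket_cong[of X Y p X' Y'] assms show ?thesis by (simp add: torsion_def)
qed

lemma torsion_uminus_right:
  assumes "X \<in> VF" "Y \<in> VF" "p \<in> U"
  shows "torsion M nab X (- Y) p = - torsion M nab X Y p"
  using torsion_scale_right[OF assms(1,2) smooth_fun_const assms(3), of "-1"]
  by (simp add: fun_Compl_def)

lemma torsion_diff_right:
  assumes "X \<in> VF" "Y \<in> VF" "Z \<in> VF" "p \<in> U"
  shows "torsion M nab X (Y - Z) p = torsion M nab X Y p - torsion M nab X Z p"
  using torsion_add_right[OF assms(1,2) vf_uminus[OF assms(3)] assms(4)]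
    torsion_uminus_right[OF assms(1,3,4)] by simp

lemma torsion_add_left:
  assumes "X \<in> VF" "Y \<in> VF" "Z \<in> VF" "p \<in> U"
  shows "torsion M nab (X + Y) Z p = torsion M nab X Z p + torsion M nab Y Z p"
  using torsion_add_right[OF assms(3,1,2,4)] by (simp add: torsion_antisym[of _ Z])

lemma torsion_scale_left:
  assumes "X \<in> VF" "Y \<in> VF" "smooth_fun M U f" "p \<in> U"
  shows "torsion M nab (\<lambda>q. f q *\<^sub>T X q) Y p = f p *\<^sub>T torsion M nab X Y p"
  using torsion_scale_right[OF assms(2,1,3,4)] by (simp add: torsion_antisym[of _ Y] fun_eq_iff)

lemma torsion_uminus_left:
  assumes "X \<in> VF" "Y \<in> VF" "p \<in> U"
  shows "torsion M nab (- X) Y p = - torsion M nab X Y p"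
  using torsion_uminus_right[OF assms(2,1,3)] by (simp add: torsion_antisym[of _ Y])

lemma vf_curvature: "X \<in> VF \<Longrightarrow> Y \<in> VF \<Longrightarrow> Z \<in> VF \<Longrightarrow> curvature M nab X Y Z \<in> VF"
  by (simp add: curvature_def vf_diff vf_cov vf_lie_bracket)

lemma vf_cov_torsion: "X \<in> VF \<Longrightarrow> Y \<in> VF \<Longrightarrow> Z \<in> VF \<Longrightarrow> cov_torsion M nab X Y Z \<in> VF"
  by (simp add: cov_torsion_def vf_diff vf_cov vf_torsion)

lemmas vf_closed = vf_torsion vf_curvature vf_cov_torsion vf_cov vf_lie_bracket vf_uminus

lemma cov_torsion_antisym:
  assumes "X \<in> VF" "Y \<in> VF" "Z \<in> VF" "p \<in> U"
  shows "cov_torsion M nab X Y Z p = - cov_torsion M nab X Z Y p"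
proof -
  have "cov nab X (torsion M nab Y Z) p = cov nab X (- torsion M nab Z Y) p"
    by (rule cov_cong) (use assms torsion_antisym[of Y Z] in \<open>simp_all add: vf_closed\<close>)
  then show ?thesis
    using cov_uminus_right[OF assms(1) vf_torsion[OF assms(3,2)] assms(4)]
      torsion_antisym[of "cov nab X Y" Z p] torsion_antisym[of Y "cov nab X Z" p]
    by (simp add: cov_torsion_def)
qed

lemma cov_torsion_cong:
  assumes "X \<in> VF" "Y \<in> VF" "Z \<in> VF" "p \<in> U"
    "\<And>q. q \<in> U \<Longrightarrow> X q = X' q" "\<And>q. q \<in> U \<Longrightarrow> Y q = Y' q" "\<And>q. q \<in> U \<Longrightarrow> Z q = Z' q"
  shows "cov_torsion M nab X Y Z p = cov_torsion M nab X' Y' Z' p"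
proof -
  have c: "cov nab X A q = cov nab X' A' q"
    if "A \<in> VF" "q \<in> U" "\<And>q. q \<in> U \<Longrightarrow> A q = A' q" for A A' q
    by (rule cov_cong) (use that assms in auto)
  have "cov nab X (torsion M nab Y Z) p = cov nab X' (torsion M nab Y' Z') p"
    by (rule c) (use assms in \<open>auto intro!: torsion_cong vf_torsion\<close>)
  moreover have "torsion M nab (cov nab X Y) Z p = torsion M nab (cov nab X' Y') Z' p"
    by (rule torsion_cong) (use assms c in \<open>auto intro!: vf_cov\<close>)
  moreover have "torsion M nab Y (cov nab X Z) p = torsion M nab Y' (cov nab X' Z') p"
    by (rule torsion_cong) (use assms c in \<open>auto intro!: vf_cov\<close>)
  ultimately show ?thesis by (simp add: cov_torsion_def)
qed

lemma cov_torsion_uminus: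
  assumes "X \<in> VF" "Y \<in> VF" "Z \<in> VF" "p \<in> U"
  shows cov_torsion_uminus1: "cov_torsion M nab (- X) Y Z p = - cov_torsion M nab X Y Z p"
    and cov_torsion_uminus3: "cov_torsion M nab X Y (- Z) p = - cov_torsion M nab X Y Z p"
proof -
  have "torsion M nab (cov nab (- X) Y) Z p = torsion M nab (- cov nab X Y) Z p"
    "torsion M nab Y (cov nab (- X) Z) p = torsion M nab Y (- cov nab X Z) p"
    "torsion M nab Y (cov nab X (- Z)) p = torsion M nab Y (- cov nab X Z) p"
    by (rule torsion_cong; use assms in \<open>simp add: vf_closed cov_uminus_left cov_uminus_right\<close>)+
  moreover have "cov nab X (torsion M nab Y (- Z)) p = cov nab X (- torsion M nab Y Z) p"
    by (rule cov_cong) (use assms in \<open>simp_all add: vf_closed torsion_uminus_right\<close>)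
  ultimately show "cov_torsion M nab (- X) Y Z p = - cov_torsion M nab X Y Z p"
    "cov_torsion M nab X Y (- Z) p = - cov_torsion M nab X Y Z p"
    using assms by (simp_all add: cov_torsion_def cov_uminus_left cov_uminus_right
        torsion_uminus_left torsion_uminus_right vf_closed)
qed

lemma cov_torsion_uminus2:
  assumes "X \<in> VF" "Y \<in> VF" "Z \<in> VF" "p \<in> U"
  shows "cov_torsion M nab X (- Y) Z p = - cov_torsion M nab X Y Z p"
proof -
  have "cov_torsion M nab X (- Y) Z p = - cov_torsion M nab X Z (- Y) p"
    by (rule cov_torsion_antisym[OF assms(1) vf_uminus[OF assms(2)] assms(3,4)])
  also have "\<dots> = cov_torsion M nab X Z Y p"
    using cov_torsion_uminus3[OF assms(1,3,2,4)] by simp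
  also have "\<dots> = - cov_torsion M nab X Y Z p"
    by (rule cov_torsion_antisym[OF assms(1,3,2,4)])
  finally show ?thesis .
qed

text \<open>Regroup the cyclic sum of the second derivatives as
  \<open>\<nabla>\<^sub>X(\<nabla>\<^sub>YZ - \<nabla>\<^sub>ZY)\<close> and substitute
  \<open>\<nabla>\<^sub>YZ - \<nabla>\<^sub>ZY = T\<^bsub>YZ\<^esub> + [Y,Z]\<close>. What the bracket contributes combines with
  \<open>-\<nabla>\<^bsub>[Y,Z]\<^esub>X\<close> to \<open>T(X,[Y,Z]) + [X,[Y,Z]]\<close>. The double brackets cancel by
  the Jacobi identity, and a second substitution for \<open>[Y,Z]\<close> produces the remaining torsion
  terms.\<close>

lemma first_bianchi:
  assumes X: "X \<in> VF" and Y: "Y \<in> VF" and Z: "Z \<in> VF" and p: "p \<in> U"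
  shows "curvature M nab X Y Z p + curvature M nab Y Z X p + curvature M nab Z X Y p
    = cov_torsion M nab X Y Z p + cov_torsion M nab Y Z X p + cov_torsion M nab Z X Y p
    + torsion M nab (torsion M nab X Y) Z p + torsion M nab (torsion M nab Y Z) X p
    + torsion M nab (torsion M nab Z X) Y p"
proof
  fix f
  have step: "cov nab A (cov nab B C) p f - cov nab A (cov nab C B) p f - cov nab (lie_bracket M B C) A p f
      = cov nab A (torsion M nab B C) p f + torsion M nab A (cov nab B C) p f
      + torsion M nab (cov nab C B) A p f + torsion M nab (torsion M nab B C) A p f
      + lie_bracket M A (lie_bracket M B C) p f"
    if A: "A \<in> VF" and B: "B \<in> VF" and C: "C \<in> VF" for A B C
  proof -
    note vfs = A B C vf_cov[OF B C] vf_cov[OF C B] vf_torsion[OF B C] vf_lie_bracket[OF B C]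
    have bracket: "lie_bracket M B C = cov nab B C - cov nab C B - torsion M nab B C"
      by (simp add: torsion_def)
    have "cov nab A (lie_bracket M B C) p
        = cov nab A (cov nab B C) p - cov nab A (cov nab C B) p - cov nab A (torsion M nab B C) p"
      unfolding bracket using vfs p by (simp add: cov_diff_right vf_diff)
    moreover have "torsion M nab A (lie_bracket M B C) p
        = torsion M nab A (cov nab B C) p - torsion M nab A (cov nab C B) p
        - torsion M nab A (torsion M nab B C) p"
      unfolding bracket using vfs p by (simp add: torsion_diff_right vf_diff)
    moreover have "torsion M nab A (lie_bracket M B C) p
        = cov nab A (lie_bracket M B C) p - cov nab (lie_bracket M B C) A p
        - lie_bracket M A (lie_bracket M B C) p"
      by (simp add: torsion_def)
    ultimately show ?thesis
      by (simp add: fun_eq_iff torsion_antisym[of _ A]) (smt (verit))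
  qed
  show "(curvature M nab X Y Z p + curvature M nab Y Z X p + curvature M nab Z X Y p) f
    = (cov_torsion M nab X Y Z p + cov_torsion M nab Y Z X p + cov_torsion M nab Z X Y p
    + torsion M nab (torsion M nab X Y) Z p + torsion M nab (torsion M nab Y Z) X p
    + torsion M nab (torsion M nab Z X) Y p) f"
    using step[OF X Y Z] step[OF Y Z X] step[OF Z X Y] fun_cong[OF jacobi_identity[OF X Y Z p], of f]
      fun_cong[OF torsion_antisym[of X "cov nab Y Z" p], of f]
      fun_cong[OF torsion_antisym[of Y "cov nab Z X" p], of f]
      fun_cong[OF torsion_antisym[of Z "cov nab X Y" p], of f]
      fun_cong[OF torsion_antisym[of "cov nab Z Y" X p], of f]
      fun_cong[OF torsion_antisym[of "cov nab X Z" Y p], of f]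
      fun_cong[OF torsion_antisym[of "cov nab Y X" Z p], of f]
    by (simp add: curvature_def cov_torsion_def)
qed

lemma curvature_cong:
  assumes "X \<in> VF" "Y \<in> VF" "Z \<in> VF" "p \<in> U"
    "\<And>q. q \<in> U \<Longrightarrow> X q = X' q" "\<And>q. q \<in> U \<Longrightarrow> Y q = Y' q" "\<And>q. q \<in> U \<Longrightarrow> Z q = Z' q"
  shows "curvature M nab X Y Z p = curvature M nab X' Y' Z' p"
proof -
  have "cov nab A (cov nab B Z) p = cov nab A' (cov nab B' Z') p"
    if "A \<in> VF" "B \<in> VF" "\<And>q. q \<in> U \<Longrightarrow> A q = A' q" "\<And>q. q \<in> U \<Longrightarrow> B q = B' q" for A A' B B'
    using that assms by (auto intro!: cov_cong vf_cov)
  moreover have "lie_bracket M X Y p = lie_bracket M X' Y' p"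
    by (rule lie_bracket_cong) (use assms in auto)
  then have "cov nab (lie_bracket M X Y) Z p = cov nab (lie_bracket M X' Y') Z' p"
    using assms by (auto intro!: cov_cong vf_lie_bracket)
  ultimately show ?thesis using assms by (simp add: curvature_def)
qed

lemma curvature_uminus_left:
  assumes "X \<in> VF" "Y \<in> VF" "Z \<in> VF" "p \<in> U"
  shows "curvature M nab (- X) Y Z p = - curvature M nab X Y Z p"
proof -
  have "cov nab Y (cov nab (- X) Z) p = cov nab Y (- cov nab X Z) p"
    using assms by (auto intro!: cov_cong simp: cov_uminus_left vf_closed)
  moreover have "cov nab (lie_bracket M (- X) Y) Z p = cov nab (- lie_bracket M X Y) Z p"
    using assms by (auto intro!: cov_cong simp: lie_bracket_uminus_left vf_closed)
  ultimately show ?thesis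
    using assms by (simp add: curvature_def cov_uminus_left cov_uminus_right vf_closed)
qed

lemma curvature_uminus_right:
  assumes "X \<in> VF" "Y \<in> VF" "Z \<in> VF" "p \<in> U"
  shows "curvature M nab X Y (- Z) p = - curvature M nab X Y Z p"
proof -
  have "cov nab A (cov nab B (- Z)) p = - cov nab A (cov nab B Z) p" if "A \<in> VF" "B \<in> VF" for A B
  proof -
    have "cov nab A (cov nab B (- Z)) p = cov nab A (- cov nab B Z) p"
      using assms that by (intro cov_cong) (simp_all add: cov_uminus_right vf_closed)
    then show ?thesis using assms that by (simp add: cov_uminus_right vf_closed)
  qed
  then show ?thesis
    using assms cov_uminus_right[OF vf_lie_bracket[OF assms(1,2)] assms(3,4)] by (simp add: curvature_def)
qed

end

section \<open>Metric connections\<close>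

locale riemannian_region = manifold_region M U
  for M :: "('a, 'e::euclidean_space) manifold" and U +
  fixes g :: "'a bilin_field"
  assumes metric: "riemannian_metric M g"
begin

lemma region_point: "p \<in> U \<Longrightarrow> p \<in> topspace (mtop M)"
  using open_U openin_subset by blast

lemma metric_rules:
  assumes "p \<in> U" "u \<in> tangent_space M p" "v \<in> tangent_space M p"
  shows metric_add_left: "w \<in> tangent_space M p \<Longrightarrow> g p (u + v) w = g p u w + g p v w"
    and metric_scale_left: "g p (c *\<^sub>T u) v = c * g p u v"
    and metric_sym: "g p u v = g p v u"
proof -
  note at = metric[unfolded riemannian_metric_def, THEN conjunct1, THEN bspec,
      OF region_point[OF assms(1)], THEN bspec, OF assms(2), THEN bspec, OF assms(3)]
  show "g p (u + v) w = g p u w + g p v w" if "w \<in> tangent_space M p"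
    by (rule at[THEN conjunct1, rule_format, OF that])
  show "g p (c *\<^sub>T u) v = c * g p u v"
    by (rule at[THEN conjunct2, THEN conjunct1, rule_format])
  show "g p u v = g p v u"
    by (rule at[THEN conjunct2, THEN conjunct2, THEN conjunct1])
qed

lemma smooth_metric: "X \<in> VF \<Longrightarrow> Y \<in> VF \<Longrightarrow> smooth_fun M U (\<lambda>q. g q (X q) (Y q))"
  by (rule metric[unfolded riemannian_metric_def, THEN conjunct2, rule_format, OF open_U])

lemma metric_add_right:
  assumes "p \<in> U" "u \<in> tangent_space M p" "v \<in> tangent_space M p" "w \<in> tangent_space M p"
  shows "g p u (v + w) = g p u v + g p u w"
  using metric_add_left[OF assms(1,3,4,2)] metric_sym[OF assms(1,2) tangent_add[OF assms(3,4)]]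
    metric_sym[OF assms(1,2,3)] metric_sym[OF assms(1,2,4)] by simp

lemma metric_scale_right:
  assumes "p \<in> U" "u \<in> tangent_space M p" "v \<in> tangent_space M p"
  shows "g p u (c *\<^sub>T v) = c * g p u v"
  using metric_scale_left[OF assms(1,3,2), of c] metric_sym[OF assms(1) tangent_scale[OF assms(3)] assms(2), of c]
    metric_sym[OF assms] by simp

lemma metric_uminus_left:
  assumes "p \<in> U" "u \<in> tangent_space M p" "v \<in> tangent_space M p"
  shows "g p (- u) v = - g p u v"
  using metric_scale_left[OF assms, of "-1"] by (simp add: fun_Compl_def)

lemma metric_uminus_right:
  assumes "p \<in> U" "u \<in> tangent_space M p" "v \<in> tangent_space M p"
  shows "g p u (- v) = - g p u v"
  using metric_scale_right[OF assms, of "-1"] by (simp add: fun_Compl_def)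

lemma metric_diff_left:
  assumes "p \<in> U" "u \<in> tangent_space M p" "v \<in> tangent_space M p" "w \<in> tangent_space M p"
  shows "g p (u - v) w = g p u w - g p v w"
  using metric_add_left[OF assms(1,2) tangent_uminus[OF assms(3)] assms(4)]
    metric_uminus_left[OF assms(1,3,4)] by simp

lemma metric_diff_right:
  assumes "p \<in> U" "u \<in> tangent_space M p" "v \<in> tangent_space M p" "w \<in> tangent_space M p"
  shows "g p u (v - w) = g p u v - g p u w"
  using metric_add_right[OF assms(1,2,3) tangent_uminus[OF assms(4)]]
    metric_uminus_right[OF assms(1,2,4)] by simp

lemma metric_zero_left:
  assumes "p \<in> U" "v \<in> tangent_space M p"
  shows "g p 0 v = 0"
  using metric_diff_left[OF assms(1) tangent_zero tangent_zero assms(2)] by simp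

lemma metric_sum_left:
  assumes "p \<in> U" "w \<in> tangent_space M p" "finite A" "\<And>i. i \<in> A \<Longrightarrow> v i \<in> tangent_space M p"
  shows "g p (\<Sum>i\<in>A. v i) w = (\<Sum>i\<in>A. g p (v i) w)"
  using assms(3,4)
  by (induction A rule: finite_induct)
    (auto simp: metric_zero_left[OF assms(1,2)] metric_add_left[OF assms(1) _ _ assms(2)] tangent_sum)

end

locale metric_connection_region = riemannian_region M U g + connection_region M U nab
  for M :: "('a, 'e::euclidean_space) manifold" and U g nab +
  assumes metric_conn: "metric_connection M g nab"
begin

lemma metric_derivative:
  assumes "X \<in> VF" "Y \<in> VF" "Z \<in> VF" "p \<in> U"
  shows "X p (\<lambda>q. g q (Y q) (Z q)) = g p (cov nab X Y p) (Z p) + g p (Y p) (cov nab X Z p)"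
  unfolding cov_def
  by (rule metric_conn[unfolded metric_connection_def, rule_format, OF open_U assms(2,3,4) vf_tangent[OF assms(1,4)]])

text \<open>Apply \<open>XY - YX = [X,Y]\<close> to the function \<open>g(Z,W)\<close>: the products of first derivatives
  are symmetric in \<open>X\<close> and \<open>Y\<close>, and only the curvature terms survive.\<close>

lemma curvature_skew:
  assumes X: "X \<in> VF" and Y: "Y \<in> VF" and Z: "Z \<in> VF" and W: "W \<in> VF" and p: "p \<in> U"
  shows "g p (curvature M nab X Y Z p) (W p) = - g p (Z p) (curvature M nab X Y W p)"
proof -
  let ?f = "\<lambda>q. g q (Z q) (W q)"
  have second: "A p (\<lambda>q. B q ?f)
      = g p (cov nab A (cov nab B Z) p) (W p) + g p (cov nab B Z p) (cov nab A W p)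
      + (g p (cov nab A Z p) (cov nab B W p) + g p (Z p) (cov nab A (cov nab B W) p))"
    if A: "A \<in> VF" and B: "B \<in> VF" for A B
  proof -
    have "A p (\<lambda>q. B q ?f) = A p (\<lambda>q. g q (cov nab B Z q) (W q) + g q (Z q) (cov nab B W q))"
      by (rule tangent_germ[OF vf_tangent[OF A p] open_U p]) (rule metric_derivative[OF B Z W])
    also have "\<dots> = A p (\<lambda>q. g q (cov nab B Z q) (W q)) + A p (\<lambda>q. g q (Z q) (cov nab B W q))"
      by (intro tangent_add_fun[OF vf_tangent[OF A p]] smooth_near_if_smooth_fun[OF smooth_metric]
          vf_cov B Z W p)
    finally show ?thesis using A B Z W p by (simp add: metric_derivative vf_cov)
  qed
  have near: "smooth_near M p ?f" by (rule smooth_near_if_smooth_fun[OF smooth_metric[OF Z W] p])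
  have "lie_bracket M X Y p ?f = X p (\<lambda>q. Y q ?f) - Y p (\<lambda>q. X q ?f)"
    by (simp add: lie_bracket_def near)
  moreover have "lie_bracket M X Y p ?f
      = g p (cov nab (lie_bracket M X Y) Z p) (W p) + g p (Z p) (cov nab (lie_bracket M X Y) W p)"
    by (rule metric_derivative[OF vf_lie_bracket[OF X Y] Z W p])
  moreover have "curvature M nab X Y C p = cov nab X (cov nab Y C) p - cov nab Y (cov nab X C) p
      - cov nab (lie_bracket M X Y) C p" for C
    by (simp add: curvature_def)
  ultimately show ?thesis
    using second[OF X Y] second[OF Y X] X Y Z W p
    by (simp add: metric_diff_left metric_diff_right tangent_diff vf_closed)
qed

end

section \<open>Orthonormal frames\<close>

lemma sum_fun_apply: "(\<Sum>i\<in>A. F i) x = (\<Sum>i\<in>A. F i x)"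
  by (induction A rule: infinite_finite_induct) auto

locale orthonormal_frame_region = riemannian_region M U g
  for M :: "('a, 'e::euclidean_space) manifold" and U g +
  fixes e :: "nat \<Rightarrow> 'a vfield"
  assumes vf_frame: "i \<in> {1..mdim M} \<Longrightarrow> e i \<in> vector_fields M U"
    and orthonormal: "q \<in> U \<Longrightarrow> i \<in> {1..mdim M} \<Longrightarrow> j \<in> {1..mdim M} \<Longrightarrow>
      g q (e i q) (e j q) = (if i = j then 1 else 0)"
    and spanning: "q \<in> U \<Longrightarrow> v \<in> tangent_space M q \<Longrightarrow> \<exists>a. v = (\<Sum>i=1..mdim M. a i *\<^sub>T e i q)"
begin

abbreviation I where "I \<equiv> {1..mdim M}"

lemma frame_tangent: "i \<in> I \<Longrightarrow> q \<in> U \<Longrightarrow> e i q \<in> tangent_space M q"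
  by (rule vf_tangent[OF vf_frame])

lemma frame_expand:
  assumes q: "q \<in> U" and v: "v \<in> tangent_space M q"
  shows "v = (\<Sum>i\<in>I. g q v (e i q) *\<^sub>T e i q)"
proof -
  obtain a where a: "v = (\<Sum>i\<in>I. a i *\<^sub>T e i q)" using spanning[OF q v] by blast
  have "g q v (e j q) = a j" if j: "j \<in> I" for j
  proof -
    have "g q v (e j q) = (\<Sum>i\<in>I. g q (a i *\<^sub>T e i q) (e j q))"
      unfolding a by (rule metric_sum_left[OF q frame_tangent[OF j q]]) (simp_all add: tangent_scale frame_tangent q)
    also have "\<dots> = (\<Sum>i\<in>I. (if i = j then a i else 0))"
    proof (rule sum.cong[OF refl])
      fix i assume i: "i \<in> I"
      show "g q (a i *\<^sub>T e i q) (e j q) = (if i = j then a i else 0)"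
        using metric_scale_left[OF q frame_tangent[OF i q] frame_tangent[OF j q]] orthonormal[OF q i j]
        by simp
    qed
    also have "\<dots> = a j" using j by simp
    finally show ?thesis .
  qed
  then show ?thesis by (subst a, intro sum.cong refl) simp
qed

lemma parseval:
  assumes q: "q \<in> U" and v: "v \<in> tangent_space M q" and w: "w \<in> tangent_space M q"
  shows "g q v w = (\<Sum>i\<in>I. g q v (e i q) * g q w (e i q))"
proof -
  have "g q v w = g q (\<Sum>i\<in>I. g q v (e i q) *\<^sub>T e i q) w"
    using frame_expand[OF q v] by simp
  also have "\<dots> = (\<Sum>i\<in>I. g q (g q v (e i q) *\<^sub>T e i q) w)"
    by (rule metric_sum_left[OF q w]) (simp_all add: tangent_scale frame_tangent q)
  also have "\<dots> = (\<Sum>i\<in>I. g q v (e i q) * g q w (e i q))"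
    by (intro sum.cong refl) (simp add: metric_scale_left[OF q frame_tangent w] metric_sym[OF q w frame_tangent] q)
  finally show ?thesis .
qed

text \<open>Tensoriality in the form in which it is used: an operator on vector fields that is linear over
  smooth functions and depends only on the restriction to \<open>U\<close> is determined at \<open>p\<close> by its
  values on the frame and by the components of its argument at \<open>p\<close>, because these components
  are smooth functions.\<close>

lemma operator_expand:
  fixes B :: "'a vfield \<Rightarrow> 'a tangent"
  assumes add: "\<And>X Y. X \<in> VF \<Longrightarrow> Y \<in> VF \<Longrightarrow> B (X + Y) = B X + B Y"
    and scale: "\<And>f X. smooth_fun M U f \<Longrightarrow> X \<in> VF \<Longrightarrow> B (\<lambda>q. f q *\<^sub>T X q) = f p *\<^sub>T B X"
    and cong: "\<And>X Y. X \<in> VF \<Longrightarrow> (\<And>q. q \<in> U \<Longrightarrow> X q = Y q) \<Longrightarrow> B X = B Y"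
    and X: "X \<in> VF" and p: "p \<in> U"
  shows "B X = (\<Sum>i\<in>I. g p (X p) (e i p) *\<^sub>T B (e i))"
proof -
  let ?c = "\<lambda>i q. g q (X q) (e i q)"
  let ?E = "\<lambda>i q. ?c i q *\<^sub>T e i q"
  have c: "smooth_fun M U (?c i)" if "i \<in> I" for i
    by (rule smooth_metric[OF X vf_frame[OF that]])
  have E: "?E i \<in> VF" if "i \<in> I" for i
    by (rule vf_scale[OF vf_frame[OF that] c[OF that]])
  have B0: "B 0 = 0"
    using scale[OF smooth_fun_const vf_zero, of 0] by (simp add: zero_fun_def)
  have "B (\<Sum>i\<in>A. ?E i) = (\<Sum>i\<in>A. ?c i p *\<^sub>T B (e i))" if "finite A" "A \<subseteq> I" for A
    using that
  proof (induction A rule: finite_induct)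
    case (insert a A)
    have "B (\<Sum>i\<in>insert a A. ?E i) = B (?E a + (\<Sum>i\<in>A. ?E i))"
      using insert.hyps by simp
    also have "\<dots> = B (?E a) + B (\<Sum>i\<in>A. ?E i)"
      by (intro add E vf_sum) (use insert in auto)
    also have "B (?E a) = ?c a p *\<^sub>T B (e a)"
      by (rule scale[OF c vf_frame]) (use insert in auto)
    finally show ?case using insert by simp
  qed (simp add: B0)
  from this[of I] have "B (\<Sum>i\<in>I. ?E i) = (\<Sum>i\<in>I. ?c i p *\<^sub>T B (e i))" by simp
  moreover have "B X = B (\<Sum>i\<in>I. ?E i)"
  proof (rule cong[OF X])
    fix q assume q: "q \<in> U"
    show "X q = (\<Sum>i\<in>I. ?E i) q"
      unfolding sum_fun_apply[of ?E _ q] by (rule frame_expand[OF q vf_tangent[OF X q]])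
  qed
  ultimately show ?thesis by simp
qed

end

text \<open>The 1-form \<open>\<theta>(Y) = tr(Z \<mapsto> T\<^bsub>YZ\<^esub>)\<close>. It is convenient to work with this
  form of \<open>\<theta>\<close>, and to compare it with \<open>\<Lambda>(dF)\<close> at the end
  (\<open>torsion_1form_eq_torsion_trace\<close>).\<close>

definition torsion_trace ::
  "('a, 'e::euclidean_space) manifold \<Rightarrow> 'a bilin_field \<Rightarrow> 'a covd \<Rightarrow> (nat \<Rightarrow> 'a vfield)
    \<Rightarrow> 'a vfield \<Rightarrow> 'a \<Rightarrow> real" where
  "torsion_trace M g nab e Y q = (\<Sum>i=1..mdim M. g q (torsion M nab Y (e i) q) (e i q))"

locale metric_frame_region =
  orthonormal_frame_region M U g e + metric_connection_region M U g nab
  for M :: "('a, 'e::euclidean_space) manifold" and U g e nab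
begin

lemma torsion_expand_right:
  assumes "X \<in> VF" "Y \<in> VF" "p \<in> U"
  shows "torsion M nab X Y p = (\<Sum>k\<in>I. g p (Y p) (e k p) *\<^sub>T torsion M nab X (e k) p)"
proof (rule operator_expand[of "\<lambda>Y. torsion M nab X Y p"])
  show "torsion M nab X A p = torsion M nab X B p" if "A \<in> VF" "\<And>q. q \<in> U \<Longrightarrow> A q = B q" for A B
    using assms that by (intro torsion_cong) auto
qed (use assms in \<open>auto simp: torsion_add_right torsion_scale_right\<close>)

lemma torsion_expand_left:
  assumes "X \<in> VF" "Y \<in> VF" "p \<in> U"
  shows "torsion M nab X Y p = (\<Sum>k\<in>I. g p (X p) (e k p) *\<^sub>T torsion M nab (e k) Y p)"
proof (rule operator_expand[of "\<lambda>X. torsion M nab X Y p"])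
  show "torsion M nab A Y p = torsion M nab B Y p" if "A \<in> VF" "\<And>q. q \<in> U \<Longrightarrow> A q = B q" for A B
    using assms that by (intro torsion_cong) auto
qed (use assms in \<open>auto simp: torsion_add_left torsion_scale_left\<close>)

lemma metric_torsion_expand_right:
  assumes "X \<in> VF" "Y \<in> VF" "p \<in> U" "w \<in> tangent_space M p"
  shows "g p (torsion M nab X Y p) w = (\<Sum>k\<in>I. g p (Y p) (e k p) * g p (torsion M nab X (e k) p) w)"
proof -
  have t: "torsion M nab X (e k) p \<in> tangent_space M p" if "k \<in> I" for k
    using assms that by (simp add: vf_torsion vf_frame)
  show ?thesis
    unfolding torsion_expand_right[OF assms(1-3)]
    by (subst metric_sum_left[OF assms(3,4)])
      (auto intro!: tangent_scale t sum.cong metric_scale_left[OF assms(3) t assms(4)])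
qed

lemma metric_torsion_expand_left:
  assumes "X \<in> VF" "Y \<in> VF" "p \<in> U" "w \<in> tangent_space M p"
  shows "g p (torsion M nab X Y p) w = (\<Sum>k\<in>I. g p (X p) (e k p) * g p (torsion M nab (e k) Y p) w)"
proof -
  have t: "torsion M nab (e k) Y p \<in> tangent_space M p" if "k \<in> I" for k
    using assms that by (simp add: vf_torsion vf_frame)
  show ?thesis
    unfolding torsion_expand_left[OF assms(1-3)]
    by (subst metric_sum_left[OF assms(3,4)])
      (auto intro!: tangent_scale t sum.cong metric_scale_left[OF assms(3) t assms(4)])
qed

lemma torsion_trace_expand:
  assumes "Y \<in> VF" "p \<in> U"
  shows "torsion_trace M g nab e Y p = (\<Sum>k\<in>I. g p (Y p) (e k p) * torsion_trace M g nab e (e k) p)"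
proof -
  have "torsion_trace M g nab e Y p
      = (\<Sum>i\<in>I. \<Sum>k\<in>I. g p (Y p) (e k p) * g p (torsion M nab (e k) (e i) p) (e i p))"
    unfolding torsion_trace_def
    by (intro sum.cong refl metric_torsion_expand_left assms vf_frame frame_tangent)
  also have "\<dots> = (\<Sum>k\<in>I. \<Sum>i\<in>I. g p (Y p) (e k p) * g p (torsion M nab (e k) (e i) p) (e i p))"
    by (rule sum.swap)
  finally show ?thesis by (simp add: torsion_trace_def sum_distrib_left)
qed

text \<open>Taking the trace commutes with covariant differentiation. The terms in which the frame is
  differentiated cancel because the connection coefficients of an orthonormal frame are
  skew-symmetric.\<close>

lemma trace_cov_torsion:
  assumes X: "X \<in> VF" and Y: "Y \<in> VF" and p: "p \<in> U"
  shows "(\<Sum>j\<in>I. g p (cov_torsion M nab X Y (e j) p) (e j p))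
    = X p (torsion_trace M g nab e Y) - torsion_trace M g nab e (cov nab X Y) p"
proof -
  let ?a = "\<lambda>j k. g p (cov nab X (e j) p) (e k p)"
  let ?b = "\<lambda>j k. g p (torsion M nab Y (e j) p) (e k p)"
  have skew: "?a j k = - ?a k j" if j: "j \<in> I" and k: "k \<in> I" for j k
  proof -
    have "X p (\<lambda>q. g q (e j q) (e k q)) = X p (\<lambda>_. if j = k then 1 else 0)"
      by (rule tangent_germ[OF vf_tangent[OF X p] open_U p]) (rule orthonormal[OF _ j k])
    also have "\<dots> = 0" by (rule tangent_const_fun[OF vf_tangent[OF X p] p])
    finally show ?thesis
      using metric_derivative[OF X vf_frame[OF j] vf_frame[OF k] p]
        metric_sym[OF p frame_tangent[OF j p] vf_tangent[OF vf_cov[OF X vf_frame[OF k]] p]]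
      by simp
  qed
  have "(\<Sum>j\<in>I. \<Sum>k\<in>I. ?a j k * ?b k j) = (\<Sum>j\<in>I. \<Sum>k\<in>I. ?a k j * ?b j k)"
    by (rule sum.swap)
  also have "\<dots> = - (\<Sum>j\<in>I. \<Sum>k\<in>I. ?a j k * ?b j k)"
    unfolding sum_negf[symmetric]
  proof (intro sum.cong refl)
    fix j k assume "j \<in> I" "k \<in> I"
    from skew[OF this(2,1)] show "?a k j * ?b j k = - (?a j k * ?b j k)" by simp
  qed
  finally have cancel: "(\<Sum>j\<in>I. \<Sum>k\<in>I. ?a j k * ?b j k) + (\<Sum>j\<in>I. \<Sum>k\<in>I. ?a j k * ?b k j) = 0"
    by simp
  have summand: "g p (cov_torsion M nab X Y (e j) p) (e j p)
      = X p (\<lambda>q. g q (torsion M nab Y (e j) q) (e j q)) - g p (torsion M nab (cov nab X Y) (e j) p) (e j p)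
      - ((\<Sum>k\<in>I. ?a j k * ?b j k) + (\<Sum>k\<in>I. ?a j k * ?b k j))"
    if j: "j \<in> I" for j
  proof -
    note ej = vf_frame[OF j] and ejp = frame_tangent[OF j p]
    note T = vf_torsion[OF Y ej] and C = vf_cov[OF X ej]
    have "g p (torsion M nab Y (e j) p) (cov nab X (e j) p) = (\<Sum>k\<in>I. ?a j k * ?b j k)"
      using parseval[OF p vf_tangent[OF T p] vf_tangent[OF C p]] by (simp add: mult.commute)
    moreover have "g p (torsion M nab Y (cov nab X (e j)) p) (e j p) = (\<Sum>k\<in>I. ?a j k * ?b k j)"
      by (rule metric_torsion_expand_right[OF Y C p ejp])
    moreover have "g p (cov_torsion M nab X Y (e j) p) (e j p)
        = g p (cov nab X (torsion M nab Y (e j)) p) (e j p)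
        - g p (torsion M nab (cov nab X Y) (e j) p) (e j p)
        - g p (torsion M nab Y (cov nab X (e j)) p) (e j p)"
      using X Y ej ejp p
      by (simp add: cov_torsion_def metric_diff_left[OF p _ _ ejp] tangent_diff vf_closed)
    ultimately show ?thesis using metric_derivative[OF X T ej p] by simp
  qed
  have "X p (torsion_trace M g nab e Y) = X p (\<lambda>q. \<Sum>j\<in>I. g q (torsion M nab Y (e j) q) (e j q))"
    by (simp add: torsion_trace_def[abs_def])
  also have "\<dots> = (\<Sum>j\<in>I. X p (\<lambda>q. g q (torsion M nab Y (e j) q) (e j q)))"
    by (rule tangent_sum_fun[OF vf_tangent[OF X p] p])
      (auto intro!: smooth_metric vf_torsion Y vf_frame)
  finally show ?thesis
    using cancel by (simp add: summand sum.distrib sum_subtractf torsion_trace_def)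
qed

end

section \<open>Adapted frames of an almost Hermitian manifold\<close>

locale hermitian_frame_region = metric_frame_region M U g e nab
  for M :: "('a, 'e::euclidean_space) manifold" and U g e nab +
  fixes J :: "'a endo_field" and n :: nat
  assumes acs: "almost_complex_structure M J"
    and metric_J: "q \<in> U \<Longrightarrow> u \<in> tangent_space M q \<Longrightarrow> v \<in> tangent_space M q \<Longrightarrow>
      g q (J q u) (J q v) = g q u v"
    and dim: "mdim M = 2 * n"
    and frame_J: "q \<in> U \<Longrightarrow> \<alpha> \<in> {1..n} \<Longrightarrow> e (2 * \<alpha>) q = J q (e (2 * \<alpha> - 1) q)"
    and complex_conn: "complex_connection M J nab"
    and torsion_J_J: "X \<in> vector_fields M U \<Longrightarrow> Y \<in> vector_fields M U \<Longrightarrow> q \<in> U \<Longrightarrow>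
      torsion M nab (app_field J X) (app_field J Y) q = - torsion M nab X Y q"
begin

abbreviation JF :: "'a vfield \<Rightarrow> 'a vfield" where "JF \<equiv> app_field J"

lemma J_rules:
  assumes "q \<in> U" "u \<in> tangent_space M q"
  shows J_tangent: "J q u \<in> tangent_space M q"
    and J_add: "v \<in> tangent_space M q \<Longrightarrow> J q (u + v) = J q u + J q v"
    and J_scale: "J q (c *\<^sub>T u) = c *\<^sub>T J q u"
    and J_J: "J q (J q u) = - u"
proof -
  note at = acs[unfolded almost_complex_structure_def, THEN conjunct1, THEN bspec,
      OF region_point[OF assms(1)], THEN bspec, OF assms(2)]
  show "J q u \<in> tangent_space M q" by (rule at[THEN conjunct1])
  show "J q (u + v) = J q u + J q v" if "v \<in> tangent_space M q"
    by (rule at[THEN conjunct2, THEN conjunct1, rule_format, OF that])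
  show "J q (c *\<^sub>T u) = c *\<^sub>T J q u"
    by (rule at[THEN conjunct2, THEN conjunct2, THEN conjunct1, rule_format])
  show "J q (J q u) = - u"
    by (rule at[THEN conjunct2, THEN conjunct2, THEN conjunct2])
qed

lemma vf_J: "X \<in> VF \<Longrightarrow> JF X \<in> VF"
  by (rule acs[unfolded almost_complex_structure_def, THEN conjunct2, rule_format, OF open_U])

lemma J_uminus:
  assumes "q \<in> U" "u \<in> tangent_space M q"
  shows "J q (- u) = - J q u"
  using J_scale[OF assms, of "-1"] by (simp add: fun_Compl_def)

lemma J_diff:
  assumes "q \<in> U" "u \<in> tangent_space M q" "v \<in> tangent_space M q"
  shows "J q (u - v) = J q u - J q v"
  using J_add[OF assms(1,2) tangent_uminus[OF assms(3)]] J_uminus[OF assms(1,3)] by simp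

lemma JF_JF: "X \<in> VF \<Longrightarrow> q \<in> U \<Longrightarrow> JF (JF X) q = (- X) q"
  by (simp add: app_field_def J_J)

lemma JF_cong: "X q = Y q \<Longrightarrow> JF X q = JF Y q"
  by (simp add: app_field_def)

lemma JF_uminus: "X \<in> VF \<Longrightarrow> q \<in> U \<Longrightarrow> JF (- X) q = (- JF X) q"
  by (simp add: app_field_def J_uminus)

lemma metric_J_left:
  assumes "q \<in> U" "u \<in> tangent_space M q" "v \<in> tangent_space M q"
  shows "g q (J q u) v = - g q u (J q v)"
  using metric_J[OF assms(1,2) J_tangent[OF assms(1,3)]] J_J[OF assms(1,3)]
    metric_uminus_right[OF assms(1) J_tangent[OF assms(1,2)] assms(3)] by simp

lemma cov_J: "X \<in> VF \<Longrightarrow> Y \<in> VF \<Longrightarrow> q \<in> U \<Longrightarrow> cov nab X (JF Y) q = JF (cov nab X Y) q"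
  unfolding cov_def app_field_def[of J "\<lambda>p. nab p (X p) Y"]
  by (rule complex_conn[unfolded complex_connection_def, rule_format, OF open_U _ _ vf_tangent])

text \<open>Put \<open>JY\<close> for \<open>Y\<close> in \<open>T\<^bsub>JX,JY\<^esub> = -T\<^bsub>XY\<^esub>\<close> and use
  \<open>J\<^sup>2 = -1\<close>.\<close>

lemma torsion_J:
  assumes "X \<in> VF" "Y \<in> VF" "q \<in> U"
  shows "torsion M nab (JF X) Y q = torsion M nab X (JF Y) q"
proof -
  have "torsion M nab (JF X) (JF (JF Y)) q = torsion M nab (JF X) (- Y) q"
    by (rule torsion_cong) (use assms in \<open>simp_all add: vf_J JF_JF\<close>)
  then show ?thesis
    using torsion_J_J[OF assms(1) vf_J[OF assms(2)] assms(3)]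
      torsion_uminus_right[OF vf_J[OF assms(1)] assms(2,3)] by simp
qed

text \<open>By \<open>torsion_J\<close>, \<open>T\<^bsub>X,JX\<^esub> = T\<^bsub>JX,X\<^esub>\<close>, and the torsion is antisymmetric.\<close>

lemma torsion_self_J:
  assumes "X \<in> VF" "q \<in> U"
  shows "torsion M nab X (JF X) q = 0"
  using torsion_J[OF assms(1,1,2)] torsion_antisym[of X "JF X" q] by (intro self_negative_tangent) simp

lemma curvature_J:
  assumes "X \<in> VF" "Y \<in> VF" "Z \<in> VF" "p \<in> U"
  shows "curvature M nab X Y (JF Z) p = J p (curvature M nab X Y Z p)"
proof -
  have "cov nab A (cov nab B (JF Z)) p = J p (cov nab A (cov nab B Z) p)" if "A \<in> VF" "B \<in> VF" for A B
  proof -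
    have "cov nab A (cov nab B (JF Z)) p = cov nab A (JF (cov nab B Z)) p"
      by (rule cov_cong) (use that assms in \<open>simp_all add: cov_J vf_J vf_closed\<close>)
    then show ?thesis using cov_J[OF that(1) vf_cov[OF that(2) assms(3)] assms(4)]
      by (simp add: app_field_def)
  qed
  then show ?thesis
    using assms cov_J[OF vf_lie_bracket[OF assms(1,2)] assms(3,4)]
    by (simp add: curvature_def app_field_def J_diff[OF assms(4)] tangent_diff vf_closed)
qed

text \<open>Since \<open>\<nabla>J = 0\<close>, the derivative of the torsion inherits the symmetry of the torsion.\<close>

lemma cov_torsion_J:
  assumes A: "A \<in> VF" and X: "X \<in> VF" and Y: "Y \<in> VF" and p: "p \<in> U"
  shows "cov_torsion M nab A (JF X) Y p = cov_torsion M nab A X (JF Y) p"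
proof -
  have "cov nab A (torsion M nab (JF X) Y) p = cov nab A (torsion M nab X (JF Y)) p"
    by (rule cov_cong) (use assms torsion_J in \<open>simp_all add: vf_J vf_closed\<close>)
  moreover have "torsion M nab (cov nab A (JF X)) Y p = torsion M nab (cov nab A X) (JF Y) p"
  proof -
    have "torsion M nab (cov nab A (JF X)) Y p = torsion M nab (JF (cov nab A X)) Y p"
      by (rule torsion_cong) (use assms cov_J in \<open>simp_all add: vf_J vf_closed\<close>)
    then show ?thesis using torsion_J[OF vf_cov[OF A X] Y p] by simp
  qed
  moreover have "torsion M nab (JF X) (cov nab A Y) p = torsion M nab X (cov nab A (JF Y)) p"
  proof -
    have "torsion M nab X (cov nab A (JF Y)) p = torsion M nab X (JF (cov nab A Y)) p"
      by (rule torsion_cong) (use assms cov_J in \<open>simp_all add: vf_J vf_closed\<close>)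
    then show ?thesis using torsion_J[OF X vf_cov[OF A Y] p] by simp
  qed
  ultimately show ?thesis by (simp add: cov_torsion_def)
qed

lemma cov_torsion_self_J:
  assumes "A \<in> VF" "X \<in> VF" "p \<in> U"
  shows "cov_torsion M nab A X (JF X) p = 0"
  using cov_torsion_J[OF assms(1,2,2,3)] cov_torsion_antisym[OF assms(1,2) vf_J[OF assms(2)] assms(3)]
  by (intro self_negative_tangent) simp

text \<open>In an adapted frame \<open>Je\<^bsub>2\<alpha>-1\<^esub> = e\<^bsub>2\<alpha>\<^esub>\<close> and
  \<open>Je\<^bsub>2\<alpha>\<^esub> = -e\<^bsub>2\<alpha>-1\<^esub>\<close>: up to sign, \<open>J\<close> permutes the frame. Every
  contraction of interest is quadratic, hence even, in each frame vector, so that \<open>Je\<^sub>i\<close> may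
  be replaced by \<open>e\<^sub>i\<close> throughout, also in terms that differentiate it.\<close>

lemma sum_J_frame:
  fixes h :: "'a vfield \<Rightarrow> real"
  assumes even: "\<And>X. X \<in> VF \<Longrightarrow> h (- X) = h X"
    and cong: "\<And>X Y. X \<in> VF \<Longrightarrow> (\<And>q. q \<in> U \<Longrightarrow> X q = Y q) \<Longrightarrow> h X = h Y"
  shows "(\<Sum>i\<in>I. h (JF (e i))) = (\<Sum>i\<in>I. h (e i))"
proof -
  have pair: "h (JF (e (2 * \<alpha> - 1))) = h (e (2 * \<alpha>))" "h (JF (e (2 * \<alpha>))) = h (e (2 * \<alpha> - 1))"
    if \<alpha>: "\<alpha> \<in> {1..n}" for \<alpha>
  proof -
    have vf: "e (2 * \<alpha> - 1) \<in> VF" "e (2 * \<alpha>) \<in> VF"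
      by (rule vf_frame; use \<alpha> dim in auto)+
    have eq: "JF (e (2 * \<alpha> - 1)) q = e (2 * \<alpha>) q" if "q \<in> U" for q
      using frame_J[OF that \<alpha>] by (simp add: app_field_def)
    show "h (JF (e (2 * \<alpha> - 1))) = h (e (2 * \<alpha>))"
      by (rule cong[OF vf_J[OF vf(1)] eq])
    have "h (JF (e (2 * \<alpha>))) = h (- e (2 * \<alpha> - 1))"
    proof (rule cong[OF vf_J[OF vf(2)]])
      fix q assume q: "q \<in> U"
      have "JF (e (2 * \<alpha>)) q = JF (JF (e (2 * \<alpha> - 1))) q"
        using eq[OF q] by (simp add: app_field_def)
      then show "JF (e (2 * \<alpha>)) q = (- e (2 * \<alpha> - 1)) q"
        using JF_JF[OF vf(1) q] by simp
    qed
    then show "h (JF (e (2 * \<alpha>))) = h (e (2 * \<alpha> - 1))" using even[OF vf(1)] by simp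
  qed
  have split: "(\<Sum>i\<in>{1..2 * k}. f i) = (\<Sum>\<alpha>\<in>{1..k}. f (2 * \<alpha> - 1) + f (2 * \<alpha>))"
    for k and f :: "nat \<Rightarrow> real"
    by (induction k) auto
  show ?thesis
    unfolding dim split
  proof (rule sum.cong[OF refl])
    fix \<alpha> assume "\<alpha> \<in> {1..n}"
    from pair[OF this] show "h (JF (e (2 * \<alpha> - 1))) + h (JF (e (2 * \<alpha>))) = h (e (2 * \<alpha> - 1)) + h (e (2 * \<alpha>))"
      by simp
  qed
qed

section \<open>Contracting the Bianchi identity\<close>

lemmas vf_all = vf_closed vf_J vf_frame

text \<open>Move \<open>J\<close> from the last argument to \<open>e\<^sub>i\<close>; then \<open>e\<^sub>i\<close> occurs only as
  \<open>Je\<^sub>i\<close>, and the frame can be exchanged.\<close>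

lemma curvature_contraction_Jei_ej_ei:
  assumes p: "p \<in> U"
  shows "(\<Sum>i\<in>I. \<Sum>j\<in>I. g p (curvature M nab (JF (e i)) (e j) (e i) p) (JF (e j) p))
    = 2 * third_scalar_curvature M g nab e p"
proof -
  have term1: "g p (curvature M nab (JF (e i)) (e j) (e i) p) (JF (e j) p)
      = - g p (curvature M nab (JF (e i)) (e j) (JF (e i)) p) (e j p)" if i: "i \<in> I" and j: "j \<in> I" for i j
  proof -
    let ?R = "\<lambda>Z. curvature M nab (JF (e i)) (e j) Z"
    note vfs = vf_frame[OF i] vf_frame[OF j]
    have R: "?R (e i) \<in> VF" using vfs by (simp add: vf_all)
    have "g p (?R (e i) p) (JF (e j) p) = - g p (J p (?R (e i) p)) (e j p)"
      using metric_J_left[OF p vf_tangent[OF R p] vf_tangent[OF vfs(2) p]] by (simp add: app_field_def)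
    then show ?thesis using curvature_J[OF vf_J[OF vfs(1)] vfs(2,1) p] by simp
  qed
  have "(\<Sum>i\<in>I. \<Sum>j\<in>I. g p (curvature M nab (JF (e i)) (e j) (e i) p) (JF (e j) p))
      = - (\<Sum>j\<in>I. \<Sum>i\<in>I. g p (curvature M nab (JF (e i)) (e j) (JF (e i)) p) (e j p))"
    by (subst sum.swap) (simp add: term1 sum_negf)
  also have "(\<Sum>j\<in>I. \<Sum>i\<in>I. g p (curvature M nab (JF (e i)) (e j) (JF (e i)) p) (e j p))
      = (\<Sum>j\<in>I. \<Sum>i\<in>I. g p (curvature M nab (e i) (e j) (e i) p) (e j p))"
  proof (rule sum.cong[OF refl], rule sum_J_frame)
    fix j X assume "j \<in> I" "X \<in> VF"
    then show "g p (curvature M nab (- X) (e j) (- X) p) (e j p) = g p (curvature M nab X (e j) X p) (e j p)"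
      using p by (simp add: curvature_uminus_left curvature_uminus_right vf_all)
  next
    fix j X Y assume "j \<in> I" "X \<in> VF" "\<And>q. q \<in> U \<Longrightarrow> X q = Y q"
    then have "curvature M nab X (e j) X p = curvature M nab Y (e j) Y p"
      using p by (intro curvature_cong) (auto simp: vf_frame)
    then show "g p (curvature M nab X (e j) X p) (e j p) = g p (curvature M nab Y (e j) Y p) (e j p)" by simp
  qed
  also have "- (\<Sum>j\<in>I. \<Sum>i\<in>I. g p (curvature M nab (e i) (e j) (e i) p) (e j p))
      = (\<Sum>j\<in>I. \<Sum>i\<in>I. g p (curvature M nab (e i) (e j) (e j) p) (e i p))"
    unfolding sum_negf[symmetric]
  proof (intro sum.cong refl)
    fix i j assume "i \<in> I" "j \<in> I"
    then have vfs: "e i \<in> VF" "e j \<in> VF" by (simp_all add: vf_frame)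
    then show "- g p (curvature M nab (e i) (e j) (e i) p) (e j p)
        = g p (curvature M nab (e i) (e j) (e j) p) (e i p)"
      using curvature_skew[OF vfs vfs p] p
        metric_sym[OF p vf_tangent[OF vfs(1) p] vf_tangent[OF vf_curvature[OF vfs vfs(2)] p]] by simp
  qed
  finally show ?thesis by (subst (asm) (2) sum.swap) (simp add: third_scalar_curvature_def)
qed

lemma curvature_contraction_ej_ei_Jei:
  assumes p: "p \<in> U"
  shows "(\<Sum>i\<in>I. \<Sum>j\<in>I. g p (curvature M nab (e j) (e i) (JF (e i)) p) (JF (e j) p))
    = 2 * third_scalar_curvature M g nab e p"
proof -
  have "(\<Sum>i\<in>I. \<Sum>j\<in>I. g p (curvature M nab (e j) (e i) (JF (e i)) p) (JF (e j) p))
      = (\<Sum>i\<in>I. \<Sum>j\<in>I. g p (curvature M nab (e j) (e i) (e i) p) (e j p))"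
  proof (intro sum.cong refl)
    fix i j assume "i \<in> I" "j \<in> I"
    then have vfs: "e i \<in> VF" "e j \<in> VF" by (simp_all add: vf_frame)
    then show "g p (curvature M nab (e j) (e i) (JF (e i)) p) (JF (e j) p)
        = g p (curvature M nab (e j) (e i) (e i) p) (e j p)"
      using curvature_J[OF vfs(2,1,1) p] p by (simp add: app_field_def metric_J vf_closed)
  qed
  then show ?thesis by (subst (asm) (2) sum.swap) (simp add: third_scalar_curvature_def)
qed

text \<open>Moving \<open>J\<close> from the second to the third argument makes the sum over \<open>j\<close> the trace of
  \<open>\<nabla>\<^bsub>e\<^sub>i\<^esub>T\<close>.\<close>

lemma cov_torsion_contraction_ei_Jei_ej:
  assumes p: "p \<in> U"
  shows "(\<Sum>i\<in>I. \<Sum>j\<in>I. g p (cov_torsion M nab (e i) (JF (e i)) (e j) p) (JF (e j) p))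
    = (\<Sum>i\<in>I. e i p (torsion_trace M g nab e (e i)) - torsion_trace M g nab e (cov nab (e i) (e i)) p)"
proof (rule sum.cong[OF refl])
  fix i assume "i \<in> I"
  then have ei: "e i \<in> VF" by (rule vf_frame)
  have "(\<Sum>j\<in>I. g p (cov_torsion M nab (e i) (JF (e i)) (e j) p) (JF (e j) p))
      = (\<Sum>j\<in>I. g p (cov_torsion M nab (e i) (e i) (JF (e j)) p) (JF (e j) p))"
    by (intro sum.cong refl) (simp add: cov_torsion_J ei vf_frame p)
  also have "\<dots> = (\<Sum>j\<in>I. g p (cov_torsion M nab (e i) (e i) (e j) p) (e j p))"
  proof (rule sum_J_frame)
    fix X assume "X \<in> VF"
    then show "g p (cov_torsion M nab (e i) (e i) (- X) p) ((- X) p) = g p (cov_torsion M nab (e i) (e i) X p) (X p)"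
      using p ei by (simp add: cov_torsion_uminus3 vf_all metric_uminus_left metric_uminus_right tangent_uminus)
  next
    fix X Y assume "X \<in> VF" and eq: "\<And>q. q \<in> U \<Longrightarrow> X q = Y q"
    then have "cov_torsion M nab (e i) (e i) X p = cov_torsion M nab (e i) (e i) Y p"
      using p ei by (intro cov_torsion_cong) auto
    then show "g p (cov_torsion M nab (e i) (e i) X p) (X p) = g p (cov_torsion M nab (e i) (e i) Y p) (Y p)"
      using eq[OF p] by simp
  qed
  also have "\<dots> = e i p (torsion_trace M g nab e (e i)) - torsion_trace M g nab e (cov nab (e i) (e i)) p"
    by (rule trace_cov_torsion[OF ei ei p])
  finally show "(\<Sum>j\<in>I. g p (cov_torsion M nab (e i) (JF (e i)) (e j) p) (JF (e j) p))
    = e i p (torsion_trace M g nab e (e i)) - torsion_trace M g nab e (cov nab (e i) (e i)) p" .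
qed

text \<open>By antisymmetry and \<open>J\<^sup>2 = -1\<close>, the summand
  \<open>(\<nabla>\<^bsub>Je\<^sub>i\<^esub>T)(e\<^sub>j, e\<^sub>i)\<close> equals
  \<open>(\<nabla>\<^bsub>f\<^esub>T)(Jf, e\<^sub>j)\<close> with \<open>f = Je\<^sub>i\<close>.\<close>

lemma cov_torsion_contraction_Jei_ej_ei:
  assumes p: "p \<in> U"
  shows "(\<Sum>i\<in>I. \<Sum>j\<in>I. g p (cov_torsion M nab (JF (e i)) (e j) (e i) p) (JF (e j) p))
    = (\<Sum>i\<in>I. \<Sum>j\<in>I. g p (cov_torsion M nab (e i) (JF (e i)) (e j) p) (JF (e j) p))"
proof -
  let ?h = "\<lambda>X. \<Sum>j\<in>I. g p (cov_torsion M nab X (JF X) (e j) p) (JF (e j) p)"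
  have "cov_torsion M nab (JF (e i)) (e j) (e i) p = cov_torsion M nab (JF (e i)) (JF (JF (e i))) (e j) p"
    if "i \<in> I" "j \<in> I" for i j
  proof -
    have vfs: "e i \<in> VF" "e j \<in> VF" using that by (simp_all add: vf_frame)
    have "cov_torsion M nab (JF (e i)) (JF (JF (e i))) (e j) p = cov_torsion M nab (JF (e i)) (- e i) (e j) p"
      by (rule cov_torsion_cong) (use vfs p in \<open>simp_all add: vf_J JF_JF\<close>)
    also have "\<dots> = - cov_torsion M nab (JF (e i)) (e i) (e j) p"
      by (rule cov_torsion_uminus2[OF vf_J[OF vfs(1)] vfs p])
    also have "\<dots> = cov_torsion M nab (JF (e i)) (e j) (e i) p"
      using cov_torsion_antisym[OF vf_J[OF vfs(1)] vfs(2,1) p] by simp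
    finally show ?thesis by simp
  qed
  then have "(\<Sum>i\<in>I. \<Sum>j\<in>I. g p (cov_torsion M nab (JF (e i)) (e j) (e i) p) (JF (e j) p))
      = (\<Sum>i\<in>I. ?h (JF (e i)))"
    by (intro sum.cong refl) simp
  also have "\<dots> = (\<Sum>i\<in>I. ?h (e i))"
  proof (rule sum_J_frame; rule sum.cong[OF refl])
    fix X j assume X: "X \<in> VF" and "j \<in> I"
    then have ej: "e j \<in> VF" by (simp add: vf_frame)
    have "cov_torsion M nab (- X) (JF (- X)) (e j) p = cov_torsion M nab (- X) (- JF X) (e j) p"
      by (rule cov_torsion_cong) (use X ej p in \<open>simp_all add: vf_all JF_uminus\<close>)
    then have "cov_torsion M nab (- X) (JF (- X)) (e j) p = cov_torsion M nab X (JF X) (e j) p"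
      using X ej p by (simp add: cov_torsion_uminus1 cov_torsion_uminus2 vf_all)
    then show "g p (cov_torsion M nab (- X) (JF (- X)) (e j) p) (JF (e j) p)
        = g p (cov_torsion M nab X (JF X) (e j) p) (JF (e j) p)" by simp
  next
    fix X Y j assume "X \<in> VF" "j \<in> I" "\<And>q. q \<in> U \<Longrightarrow> X q = Y q"
    then have "cov_torsion M nab X (JF X) (e j) p = cov_torsion M nab Y (JF Y) (e j) p"
      using p by (intro cov_torsion_cong) (auto intro!: JF_cong simp: vf_all)
    then show "g p (cov_torsion M nab X (JF X) (e j) p) (JF (e j) p)
        = g p (cov_torsion M nab Y (JF Y) (e j) p) (JF (e j) p)" by simp
  qed
  finally show ?thesis .
qed

text \<open>Both sides are obtained from \<open>-T(T\<^bsub>f,e\<^sub>j\<^esub>, Jf)\<close>, on the left with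
  \<open>f = Je\<^sub>i\<close> and on the right, by antisymmetry, with \<open>f = e\<^sub>i\<close>.\<close>

lemma torsion_square_contraction_Jei_ej_ei:
  assumes p: "p \<in> U"
  shows "(\<Sum>i\<in>I. \<Sum>j\<in>I. g p (torsion M nab (torsion M nab (JF (e i)) (e j)) (e i) p) (JF (e j) p))
    = (\<Sum>i\<in>I. \<Sum>j\<in>I. g p (torsion M nab (torsion M nab (e j) (e i)) (JF (e i)) p) (JF (e j) p))"
proof -
  let ?h = "\<lambda>j X. g p (torsion M nab (torsion M nab X (e j)) (JF X) p) (JF (e j) p)"
  have "torsion M nab (torsion M nab (JF (e i)) (e j)) (JF (JF (e i))) p
      = - torsion M nab (torsion M nab (JF (e i)) (e j)) (e i) p" if "i \<in> I" "j \<in> I" for i j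
  proof -
    have vfs: "e i \<in> VF" "e j \<in> VF" using that by (simp_all add: vf_frame)
    have "torsion M nab (torsion M nab (JF (e i)) (e j)) (JF (JF (e i))) p
        = torsion M nab (torsion M nab (JF (e i)) (e j)) (- e i) p"
      by (rule torsion_cong) (use vfs p in \<open>simp_all add: vf_all JF_JF\<close>)
    then show ?thesis using vfs p by (simp add: torsion_uminus_right vf_all)
  qed
  then have 1: "g p (torsion M nab (torsion M nab (JF (e i)) (e j)) (e i) p) (JF (e j) p)
      = - ?h j (JF (e i))" if "i \<in> I" "j \<in> I" for i j
    using that p by (simp add: metric_uminus_left vf_all)
  have 2: "torsion M nab (torsion M nab (e j) (e i)) (JF (e i)) p
      = - torsion M nab (torsion M nab (e i) (e j)) (JF (e i)) p" if "i \<in> I" "j \<in> I" for i j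
  proof -
    have vfs: "e i \<in> VF" "e j \<in> VF" using that by (simp_all add: vf_frame)
    have "torsion M nab (torsion M nab (e j) (e i)) (JF (e i)) p
        = torsion M nab (- torsion M nab (e i) (e j)) (JF (e i)) p"
      by (rule torsion_cong) (use vfs p torsion_antisym[of "e j" "e i"] in \<open>simp_all add: vf_all\<close>)
    then show ?thesis using vfs p by (simp add: torsion_uminus_left vf_all)
  qed
  have "(\<Sum>i\<in>I. ?h j (JF (e i))) = (\<Sum>i\<in>I. ?h j (e i))" if "j \<in> I" for j
  proof (rule sum_J_frame)
    have ej: "e j \<in> VF" using that by (rule vf_frame)
    fix X assume X: "X \<in> VF"
    have "torsion M nab (torsion M nab (- X) (e j)) (JF (- X)) p
        = torsion M nab (- torsion M nab X (e j)) (- JF X) p"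
      by (rule torsion_cong) (use X ej p in \<open>simp_all add: vf_all torsion_uminus_left JF_uminus\<close>)
    then show "?h j (- X) = ?h j X"
      using X ej p by (simp add: torsion_uminus_left torsion_uminus_right vf_all)
    fix Y assume eq: "\<And>q. q \<in> U \<Longrightarrow> X q = Y q"
    have "torsion M nab (torsion M nab X (e j)) (JF X) p = torsion M nab (torsion M nab Y (e j)) (JF Y) p"
      by (rule torsion_cong) (use X ej p eq in \<open>auto intro!: torsion_cong JF_cong simp: vf_all\<close>)
    then show "?h j X = ?h j Y" by simp
  qed
  then have "(\<Sum>j\<in>I. \<Sum>i\<in>I. - ?h j (JF (e i))) = (\<Sum>j\<in>I. \<Sum>i\<in>I. - ?h j (e i))"
    by (simp add: sum_negf)
  then have "(\<Sum>i\<in>I. \<Sum>j\<in>I. - ?h j (JF (e i))) = (\<Sum>i\<in>I. \<Sum>j\<in>I. - ?h j (e i))"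
    by (subst (1 2) sum.swap)
  moreover have "(\<Sum>i\<in>I. \<Sum>j\<in>I. g p (torsion M nab (torsion M nab (JF (e i)) (e j)) (e i) p) (JF (e j) p))
      = (\<Sum>i\<in>I. \<Sum>j\<in>I. - ?h j (JF (e i)))"
    by (intro sum.cong refl 1)
  moreover have "(\<Sum>i\<in>I. \<Sum>j\<in>I. g p (torsion M nab (torsion M nab (e j) (e i)) (JF (e i)) p) (JF (e j) p))
      = (\<Sum>i\<in>I. \<Sum>j\<in>I. - ?h j (e i))"
    by (intro sum.cong refl) (simp add: 2 metric_uminus_left vf_all p)
  ultimately show ?thesis by (simp only:)
qed

text \<open>Write \<open>T\<^bsub>e\<^sub>je\<^sub>i\<^esub> = -T\<^bsub>Je\<^sub>j,Je\<^sub>i\<^esub>\<close>. Then only \<open>Je\<^sub>i\<close> and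
  \<open>Je\<^sub>j\<close> occur, \<open>J\<close> can be removed from the whole sum, and the inner torsion is
  expanded in the frame.\<close>

lemma torsion_square_contraction_ej_ei_Jei:
  assumes p: "p \<in> U"
  shows "(\<Sum>i\<in>I. \<Sum>j\<in>I. g p (torsion M nab (torsion M nab (e j) (e i)) (JF (e i)) p) (JF (e j) p))
    = (\<Sum>i\<in>I. \<Sum>j\<in>I. \<Sum>k\<in>I. g p (torsion M nab (e i) (e j) p) (e k p) * g p (torsion M nab (e k) (e i) p) (e j p))"
proof -
  let ?h = "\<lambda>Y X. g p (torsion M nab (torsion M nab Y X) X p) (Y p)"
  have 1: "g p (torsion M nab (torsion M nab (e j) (e i)) (JF (e i)) p) (JF (e j) p) = - ?h (JF (e j)) (JF (e i))"
    if "i \<in> I" "j \<in> I" for i j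
  proof -
    have vfs: "e i \<in> VF" "e j \<in> VF" using that by (simp_all add: vf_frame)
    have "torsion M nab (torsion M nab (e j) (e i)) (JF (e i)) p
        = torsion M nab (- torsion M nab (JF (e j)) (JF (e i))) (JF (e i)) p"
      by (rule torsion_cong) (use vfs p in \<open>simp_all add: vf_all torsion_J_J\<close>)
    then show ?thesis using vfs p by (simp add: torsion_uminus_left metric_uminus_left vf_all)
  qed
  have even: "?h (- Y) X = ?h Y X" "?h Y (- X) = ?h Y X" if X: "X \<in> VF" and Y: "Y \<in> VF" for X Y
  proof -
    have "torsion M nab (torsion M nab (- Y) X) X p = torsion M nab (- torsion M nab Y X) X p"
      "torsion M nab (torsion M nab Y (- X)) (- X) p = torsion M nab (- torsion M nab Y X) (- X) p"
      by (rule torsion_cong; use X Y p in \<open>simp add: vf_all torsion_uminus_left torsion_uminus_right\<close>)+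
    then show "?h (- Y) X = ?h Y X" "?h Y (- X) = ?h Y X"
      using X Y p by (simp_all add: torsion_uminus_left torsion_uminus_right vf_all
          metric_uminus_left metric_uminus_right tangent_uminus)
  qed
  have cong: "?h Y X = ?h Y' X'" if X: "X \<in> VF" and Y: "Y \<in> VF"
    and "\<And>q. q \<in> U \<Longrightarrow> X q = X' q" "\<And>q. q \<in> U \<Longrightarrow> Y q = Y' q" for X X' Y Y'
  proof -
    have "torsion M nab (torsion M nab Y X) X p = torsion M nab (torsion M nab Y' X') X' p"
      by (rule torsion_cong) (use that p in \<open>auto intro!: torsion_cong simp: vf_all\<close>)
    with that p show ?thesis by simp
  qed
  have "(\<Sum>i\<in>I. \<Sum>j\<in>I. ?h (JF (e j)) (JF (e i))) = (\<Sum>i\<in>I. \<Sum>j\<in>I. ?h (e j) (JF (e i)))"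
    by (intro sum.cong refl sum_J_frame even cong) (auto simp: vf_all)
  also have "\<dots> = (\<Sum>j\<in>I. \<Sum>i\<in>I. ?h (e j) (JF (e i)))" by (rule sum.swap)
  also have "\<dots> = (\<Sum>j\<in>I. \<Sum>i\<in>I. ?h (e j) (e i))"
    by (intro sum.cong refl sum_J_frame even cong) (auto simp: vf_all)
  also have "\<dots> = (\<Sum>i\<in>I. \<Sum>j\<in>I. ?h (e j) (e i))" by (rule sum.swap)
  finally have J_removed: "(\<Sum>i\<in>I. \<Sum>j\<in>I. ?h (JF (e j)) (JF (e i))) = (\<Sum>i\<in>I. \<Sum>j\<in>I. ?h (e j) (e i))" .
  have 2: "- ?h (e j) (e i)
      = (\<Sum>k\<in>I. g p (torsion M nab (e i) (e j) p) (e k p) * g p (torsion M nab (e k) (e i) p) (e j p))"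
    if "i \<in> I" "j \<in> I" for i j
  proof -
    have vfs: "e i \<in> VF" "e j \<in> VF" using that by (simp_all add: vf_frame)
    have flip: "g p (torsion M nab (e i) (e j) p) (e k p) = - g p (torsion M nab (e j) (e i) p) (e k p)"
      if "k \<in> I" for k
      using torsion_antisym[of "e i" "e j" p] metric_uminus_left[OF p, of "torsion M nab (e j) (e i) p" "e k p"]
        vfs that p by (simp add: vf_all)
    show ?thesis
      unfolding metric_torsion_expand_left[OF vf_torsion[OF vfs(2,1)] vfs(1) p vf_tangent[OF vfs(2) p]]
        sum_negf[symmetric]
      by (rule sum.cong[OF refl]) (simp only: flip minus_mult_left)
  qed
  have "(\<Sum>i\<in>I. \<Sum>j\<in>I. g p (torsion M nab (torsion M nab (e j) (e i)) (JF (e i)) p) (JF (e j) p))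
      = - (\<Sum>i\<in>I. \<Sum>j\<in>I. ?h (JF (e j)) (JF (e i)))"
    unfolding sum_negf[symmetric] by (intro sum.cong refl 1)
  also have "\<dots> = (\<Sum>i\<in>I. \<Sum>j\<in>I. - ?h (e j) (e i))" by (simp only: J_removed sum_negf)
  also have "\<dots> = (\<Sum>i\<in>I. \<Sum>j\<in>I. \<Sum>k\<in>I. g p (torsion M nab (e i) (e j) p) (e k p) * g p (torsion M nab (e k) (e i) p) (e j p))"
    by (intro sum.cong refl 2)
  finally show ?thesis .
qed

lemma torsion_square_ei_Jei_ej:
  assumes p: "p \<in> U" and "i \<in> I" "j \<in> I"
  shows "torsion M nab (torsion M nab (e i) (JF (e i))) (e j) p = 0"
proof -
  have vfs: "e i \<in> VF" "e j \<in> VF" using assms by (simp_all add: vf_frame)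
  have "torsion M nab (torsion M nab (e i) (JF (e i))) (e j) p = torsion M nab (\<lambda>q. 0 *\<^sub>T e i q) (e j) p"
    by (rule torsion_cong) (use vfs p torsion_self_J in \<open>simp_all add: vf_all zero_fun_def\<close>)
  also have "\<dots> = 0"
    using torsion_scale_left[OF vfs smooth_fun_const p, of 0] by (simp add: zero_fun_def)
  finally show ?thesis .
qed

text \<open>The contracted Bianchi identity, divided by \<open>-4\<close>.\<close>

lemma scalar_curvature_difference:
  assumes p: "p \<in> U"
  shows "chern_scalar_curvature M J g nab e p - third_scalar_curvature M g nab e p
    = - 1/2 * (\<Sum>i\<in>I. e i p (torsion_trace M g nab e (e i)) - torsion_trace M g nab e (cov nab (e i) (e i)) p)
    - 1/2 * (\<Sum>i\<in>I. \<Sum>j\<in>I. \<Sum>k\<in>I. g p (torsion M nab (e i) (e j) p) (e k p) * g p (torsion M nab (e k) (e i) p) (e j p))"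
proof -
  let ?G = "\<lambda>F. \<Sum>i\<in>I. \<Sum>j\<in>I. g p (F i j p) (JF (e j) p)"
  let ?R = "curvature M nab" and ?N = "cov_torsion M nab" and ?T = "torsion M nab"
  have bianchi: "g p (?R (e i) (JF (e i)) (e j) p) w + g p (?R (JF (e i)) (e j) (e i) p) w
        + g p (?R (e j) (e i) (JF (e i)) p) w
      = g p (?N (e i) (JF (e i)) (e j) p) w + g p (?N (JF (e i)) (e j) (e i) p) w
        + g p (?T (?T (JF (e i)) (e j)) (e i) p) w + g p (?T (?T (e j) (e i)) (JF (e i)) p) w"
    if "i \<in> I" "j \<in> I" and w: "w \<in> tangent_space M p" for i j w
  proof -
    have vfs: "e i \<in> VF" "JF (e i) \<in> VF" "e j \<in> VF" using that by (simp_all add: vf_all)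
    have "?R (e i) (JF (e i)) (e j) p + ?R (JF (e i)) (e j) (e i) p + ?R (e j) (e i) (JF (e i)) p
        = ?N (e i) (JF (e i)) (e j) p + ?N (JF (e i)) (e j) (e i) p
        + ?T (?T (JF (e i)) (e j)) (e i) p + ?T (?T (e j) (e i)) (JF (e i)) p"
      using first_bianchi[OF vfs p] cov_torsion_self_J[OF vfs(3,1) p] torsion_square_ei_Jei_ej[OF p that(1,2)]
      by simp
    from arg_cong[OF this, of "\<lambda>v. g p v w"] show ?thesis
      using vfs p w by (simp add: metric_add_left tangent_add vf_closed)
  qed
  have "?G (\<lambda>i j. ?R (e i) (JF (e i)) (e j)) + ?G (\<lambda>i j. ?R (JF (e i)) (e j) (e i))
        + ?G (\<lambda>i j. ?R (e j) (e i) (JF (e i)))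
      = ?G (\<lambda>i j. ?N (e i) (JF (e i)) (e j)) + ?G (\<lambda>i j. ?N (JF (e i)) (e j) (e i))
        + ?G (\<lambda>i j. ?T (?T (JF (e i)) (e j)) (e i)) + ?G (\<lambda>i j. ?T (?T (e j) (e i)) (JF (e i)))"
    unfolding sum.distrib[symmetric]
    by (intro sum.cong refl bianchi) (simp_all add: vf_all p)
  moreover have "?G (\<lambda>i j. ?R (e i) (JF (e i)) (e j)) = - 4 * chern_scalar_curvature M J g nab e p"
    by (simp add: chern_scalar_curvature_def app_field_def)
  ultimately show ?thesis
    using curvature_contraction_Jei_ej_ei[OF p] curvature_contraction_ej_ei_Jei[OF p] cov_torsion_contraction_ei_Jei_ej[OF p]
      cov_torsion_contraction_Jei_ej_ei[OF p] torsion_square_contraction_Jei_ej_ei[OF p] torsion_square_contraction_ej_ei_Jei[OF p]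
    by simp
qed

section \<open>The torsion one-form and the codifferential\<close>

text \<open>Because \<open>\<nabla>F = 0\<close>, \<open>dF(A,B,C)\<close> is the cyclic sum of \<open>F(T\<^bsub>AB\<^esub>, C)\<close>.
  For \<open>A = e\<^sub>i\<close>, \<open>B = Je\<^sub>i\<close> one term vanishes, and each of the other two
  contributes the trace of the torsion, which accounts for the factor \<open>1/2\<close> in
  \<open>\<Lambda>\<close>.\<close>

lemma torsion_1form_eq_torsion_trace:
  assumes X: "X \<in> VF" and p: "p \<in> U"
  shows "torsion_1form M J g e X p = torsion_trace M g nab e X p"
proof -
  let ?F = "fundamental_form J g" and ?T = "torsion M nab"
  have dF: "ext_deriv2 M ?F A B C p
      = g p (J p (?T A B p)) (C p) - g p (J p (?T A C p)) (B p) + g p (J p (?T B C p)) (A p)"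
    if A: "A \<in> VF" and B: "B \<in> VF" and C: "C \<in> VF" for A B C
  proof -
    have derivative: "Y p (\<lambda>q. ?F q (Z q) (W q))
        = g p (J p (cov nab Y Z p)) (W p) - g p (J p (cov nab Y W p)) (Z p)"
      if Y: "Y \<in> VF" and Z: "Z \<in> VF" and W: "W \<in> VF" for Y Z W
    proof -
      have "Y p (\<lambda>q. ?F q (Z q) (W q)) = Y p (\<lambda>q. g q (JF Z q) (W q))"
        by (simp add: fundamental_form_def app_field_def)
      also have "\<dots> = g p (JF (cov nab Y Z) p) (W p) + g p (JF Z p) (cov nab Y W p)"
        using metric_derivative[OF Y vf_J[OF Z] W p] cov_J[OF Y Z p] by simp
      also have "g p (JF Z p) (cov nab Y W p) = - g p (J p (cov nab Y W p)) (Z p)"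
        using metric_J_left[OF p vf_tangent[OF Z p] vf_tangent[OF vf_cov[OF Y W] p]]
          metric_sym[OF p vf_tangent[OF Z p] J_tangent[OF p vf_tangent[OF vf_cov[OF Y W] p]]]
        by (simp add: app_field_def)
      finally show ?thesis by (simp add: app_field_def)
    qed
    have bracket: "?F p (lie_bracket M Y Z p) (W p)
        = g p (J p (cov nab Y Z p)) (W p) - g p (J p (cov nab Z Y p)) (W p) - g p (J p (?T Y Z p)) (W p)"
      if Y: "Y \<in> VF" and Z: "Z \<in> VF" and W: "W \<in> VF" for Y Z W
    proof -
      have "lie_bracket M Y Z p = cov nab Y Z p - cov nab Z Y p - ?T Y Z p"
        by (simp add: torsion_def)
      then show ?thesis
        using Y Z W p
        by (simp add: fundamental_form_def J_diff metric_diff_left J_tangent tangent_diff vf_closed)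
    qed
    show ?thesis
      unfolding ext_deriv2_def using A B C by (simp add: derivative bracket)
  qed
  have summand: "ext_deriv2 M ?F (e i) (JF (e i)) X p
      = g p (?T X (e i) p) (e i p) + g p (?T X (JF (e i)) p) (JF (e i) p)" if "i \<in> I" for i
  proof -
    have vfs: "e i \<in> VF" "JF (e i) \<in> VF" using that by (simp_all add: vf_all)
    have "g p (J p (?T (e i) (JF (e i)) p)) (X p) = 0"
      using torsion_self_J[OF vfs(1) p] J_scale[OF p tangent_zero, of 0] metric_zero_left[OF p vf_tangent[OF X p]]
      by (simp add: zero_fun_def)
    moreover have "g p (J p (?T (e i) X p)) (JF (e i) p) = - g p (?T X (e i) p) (e i p)"
      using torsion_antisym[of "e i" X p] vfs X p
      by (simp add: app_field_def metric_J metric_uminus_left vf_closed tangent_uminus)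
    moreover have "g p (J p (?T (JF (e i)) X p)) (e i p) = g p (?T X (JF (e i)) p) (JF (e i) p)"
    proof -
      have "g p (J p (?T (JF (e i)) X p)) (e i p) = - g p (?T (JF (e i)) X p) (JF (e i) p)"
        using metric_J_left[OF p vf_tangent[OF vf_torsion[OF vfs(2) X] p] vf_tangent[OF vfs(1) p]]
        by (simp add: app_field_def)
      also have "\<dots> = g p (?T X (JF (e i)) p) (JF (e i) p)"
        using torsion_antisym[of "JF (e i)" X p] vfs X p by (simp add: metric_uminus_left vf_closed)
      finally show ?thesis .
    qed
    ultimately show ?thesis by (simp add: dF[OF vfs X])
  qed
  have "(\<Sum>i\<in>I. g p (?T X (JF (e i)) p) (JF (e i) p)) = (\<Sum>i\<in>I. g p (?T X (e i) p) (e i p))"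
  proof (rule sum_J_frame)
    fix Y assume Y: "Y \<in> VF"
    then show "g p (?T X (- Y) p) ((- Y) p) = g p (?T X Y p) (Y p)"
      using X p by (simp add: torsion_uminus_right metric_uminus_left metric_uminus_right vf_closed tangent_uminus)
    fix Z assume eq: "\<And>q. q \<in> U \<Longrightarrow> Y q = Z q"
    have "?T X Y p = ?T X Z p" by (rule torsion_cong) (use X Y p eq in auto)
    with eq[OF p] show "g p (?T X Y p) (Y p) = g p (?T X Z p) (Z p)" by simp
  qed
  then show ?thesis
    by (simp add: torsion_1form_def torsion_trace_def summand sum.distrib)
qed

text \<open>Put \<open>A = \<nabla> - D\<close>. Both connections are metric, so \<open>A\<^sub>X\<close> is skew, and
  \<open>A\<^sub>XY - A\<^sub>YX = T\<^bsub>XY\<^esub>\<close> because \<open>D\<close> has no torsion. Therefore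
  \<open>g(A\<^bsub>e\<^sub>i\<^esub>e\<^sub>i, e\<^sub>k) = -g(e\<^sub>i, A\<^bsub>e\<^sub>i\<^esub>e\<^sub>k)
  = g(e\<^sub>i, T\<^bsub>e\<^sub>ke\<^sub>i\<^esub>) - g(e\<^sub>i, A\<^bsub>e\<^sub>k\<^esub>e\<^sub>i)\<close>, and the last term is
  \<open>0\<close>. Summed over \<open>i\<close> this is \<open>\<theta>(e\<^sub>k)\<close>, whence
  \<open>\<Sum>\<^sub>i \<theta>(A\<^bsub>e\<^sub>i\<^esub>e\<^sub>i) = |\<theta>|\<^sup>2\<close>.\<close>

lemma codifferential_torsion_1form:
  assumes D: "levi_civita_connection M g D" and p: "p \<in> U"
  shows "codifferential M D e (torsion_1form M J g e) p
    = - (\<Sum>i\<in>I. e i p (torsion_trace M g nab e (e i)) - torsion_trace M g nab e (cov nab (e i) (e i)) p)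
      - norm_sq_1form M e (torsion_1form M J g e) p"
proof -
  let ?\<theta> = "torsion_trace M g nab e"
  interpret D: metric_connection_region M U g D
    using D by unfold_locales (auto simp: levi_civita_connection_def)
  have D_torsion_free: "torsion M D X Y p = 0" if "X \<in> VF" "Y \<in> VF" for X Y
    using D open_U that p unfolding levi_civita_connection_def by blast
  have difference: "g p (cov nab (e i) (e i) p - cov D (e i) (e i) p) (e k p) = g p (torsion M nab (e k) (e i) p) (e i p)"
    if "i \<in> I" "k \<in> I" for i k
  proof -
    have vfs: "e i \<in> VF" "e k \<in> VF" using that by (simp_all add: vf_frame)
    note tan = vf_tangent[OF vfs(1) p] vf_tangent[OF vfs(2) p]
    have nab_D: "cov nab (e i) (e k) p - cov D (e i) (e k) p
        = cov nab (e k) (e i) p - cov D (e k) (e i) p - torsion M nab (e k) (e i) p"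
      using D_torsion_free[OF vfs] torsion_antisym[of "e i" "e k" p]
      by (simp add: torsion_def algebra_simps)
    have diff_k: "g p (e i p) (cov nab (e k) (e i) p - cov D (e k) (e i) p) = 0"
      using metric_derivative[OF vfs(2,1,1) p] D.metric_derivative[OF vfs(2,1,1) p] vfs p
        metric_sym[OF p tan(1) vf_tangent[OF vf_cov[OF vfs(2,1)] p]]
        metric_sym[OF p tan(1) vf_tangent[OF D.vf_cov[OF vfs(2,1)] p]]
      by (simp add: metric_diff_right vf_closed D.vf_closed)
    have "g p (cov nab (e i) (e i) p - cov D (e i) (e i) p) (e k p)
        = - g p (e i p) (cov nab (e i) (e k) p - cov D (e i) (e k) p)"
      using metric_derivative[OF vfs(1,1,2) p] D.metric_derivative[OF vfs(1,1,2) p] vfs p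
      by (simp add: metric_diff_left metric_diff_right vf_closed D.vf_closed)
    also have "\<dots> = g p (e i p) (torsion M nab (e k) (e i) p)"
      unfolding nab_D using diff_k vfs p
      by (simp add: metric_diff_right[of p "e i p" "_ - _"] tangent_diff vf_closed D.vf_closed)
    also have "\<dots> = g p (torsion M nab (e k) (e i) p) (e i p)"
      by (rule metric_sym[OF p tan(1) vf_tangent[OF vf_torsion[OF vfs(2,1)] p]])
    finally show ?thesis .
  qed
  have "?\<theta> (cov nab (e i) (e i)) p - ?\<theta> (cov D (e i) (e i)) p
      = (\<Sum>k\<in>I. g p (torsion M nab (e k) (e i) p) (e i p) * ?\<theta> (e k) p)" if i: "i \<in> I" for i
  proof -
    have vfs: "cov nab (e i) (e i) \<in> VF" "cov D (e i) (e i) \<in> VF"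
      using i by (simp_all add: vf_frame vf_cov D.vf_cov)
    have "?\<theta> (cov nab (e i) (e i)) p - ?\<theta> (cov D (e i) (e i)) p
      = (\<Sum>k\<in>I. (g p (cov nab (e i) (e i) p) (e k p) - g p (cov D (e i) (e i) p) (e k p)) * ?\<theta> (e k) p)"
      by (simp add: torsion_trace_expand[OF vfs(1) p] torsion_trace_expand[OF vfs(2) p]
          left_diff_distrib sum_subtractf)
    also have "\<dots> = (\<Sum>k\<in>I. g p (torsion M nab (e k) (e i) p) (e i p) * ?\<theta> (e k) p)"
    proof (rule sum.cong[OF refl])
      fix k assume k: "k \<in> I"
      show "(g p (cov nab (e i) (e i) p) (e k p) - g p (cov D (e i) (e i) p) (e k p)) * ?\<theta> (e k) p
          = g p (torsion M nab (e k) (e i) p) (e i p) * ?\<theta> (e k) p"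
        using difference[OF i k] metric_diff_left[OF p vf_tangent[OF vfs(1) p] vf_tangent[OF vfs(2) p] frame_tangent[OF k p]]
        by simp
    qed
    finally show ?thesis .
  qed
  then have "(\<Sum>i\<in>I. ?\<theta> (cov nab (e i) (e i)) p - ?\<theta> (cov D (e i) (e i)) p)
      = (\<Sum>i\<in>I. \<Sum>k\<in>I. g p (torsion M nab (e k) (e i) p) (e i p) * ?\<theta> (e k) p)"
    by simp
  also have "\<dots> = (\<Sum>k\<in>I. (?\<theta> (e k) p)\<^sup>2)"
    by (subst sum.swap) (simp add: torsion_trace_def power2_eq_square sum_distrib_right)
  also have "\<dots> = norm_sq_1form M e (torsion_1form M J g e) p"
    by (simp add: norm_sq_1form_def torsion_1form_eq_torsion_trace vf_frame p)
  finally have norm: "(\<Sum>i\<in>I. ?\<theta> (cov nab (e i) (e i)) p - ?\<theta> (cov D (e i) (e i)) p)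
      = norm_sq_1form M e (torsion_1form M J g e) p" .
  have "codifferential M D e (torsion_1form M J g e) p
      = - (\<Sum>i\<in>I. e i p (?\<theta> (e i)) - ?\<theta> (cov D (e i) (e i)) p)"
    unfolding codifferential_def
  proof (intro arg_cong[of _ _ uminus] sum.cong refl)
    fix i assume "i \<in> I"
    then have ei: "e i \<in> VF" by (rule vf_frame)
    have "e i p (\<lambda>q. torsion_1form M J g e (e i) q) = e i p (?\<theta> (e i))"
      by (rule tangent_germ[OF vf_tangent[OF ei p] open_U p torsion_1form_eq_torsion_trace[OF ei]])
    then show "e i p (\<lambda>q. torsion_1form M J g e (e i) q) - torsion_1form M J g e (cov D (e i) (e i)) p
        = e i p (?\<theta> (e i)) - ?\<theta> (cov D (e i) (e i)) p"
      using torsion_1form_eq_torsion_trace[OF D.vf_cov[OF ei ei] p] by simp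
  qed
  with norm show ?thesis by (simp add: sum_subtractf)
qed

section \<open>Norms of the torsion\<close>

lemma sum_cyclic:
  fixes F :: "'b \<Rightarrow> 'b \<Rightarrow> 'b \<Rightarrow> 'c::comm_monoid_add"
  shows "(\<Sum>i\<in>A. \<Sum>j\<in>A. \<Sum>k\<in>A. F j k i) = (\<Sum>i\<in>A. \<Sum>j\<in>A. \<Sum>k\<in>A. F i j k)"
proof -
  have "(\<Sum>i\<in>A. \<Sum>j\<in>A. \<Sum>k\<in>A. F j k i) = (\<Sum>j\<in>A. \<Sum>i\<in>A. \<Sum>k\<in>A. F j k i)"
    by (rule sum.swap)
  also have "\<dots> = (\<Sum>j\<in>A. \<Sum>k\<in>A. \<Sum>i\<in>A. F j k i)"
    by (intro sum.cong refl sum.swap)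
  finally show ?thesis .
qed

text \<open>All squares have the same sum by rotation of the indices, and so have all mixed products.\<close>

lemma sum_square_cyclic:
  fixes \<tau> :: "'b \<Rightarrow> 'b \<Rightarrow> 'b \<Rightarrow> real"
  shows "(\<Sum>i\<in>A. \<Sum>j\<in>A. \<Sum>k\<in>A. (\<tau> j k i + \<tau> i j k + \<tau> k i j)\<^sup>2)
    = 3 * (\<Sum>i\<in>A. \<Sum>j\<in>A. \<Sum>k\<in>A. (\<tau> i j k)\<^sup>2) + 6 * (\<Sum>i\<in>A. \<Sum>j\<in>A. \<Sum>k\<in>A. \<tau> i j k * \<tau> k i j)"
proof -
  let ?S = "\<lambda>F. \<Sum>i\<in>A. \<Sum>j\<in>A. \<Sum>k\<in>A. (F i j k :: real)"
  have rotate: "?S (\<lambda>i j k. F j k i) = ?S F" "?S (\<lambda>i j k. F k i j) = ?S F" for F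
    using sum_cyclic[of F A] sum_cyclic[of "\<lambda>i j k. F k i j" A] by simp_all
  have "?S (\<lambda>i j k. (\<tau> j k i + \<tau> i j k + \<tau> k i j)\<^sup>2)
      = ?S (\<lambda>i j k. (\<tau> j k i)\<^sup>2) + ?S (\<lambda>i j k. (\<tau> i j k)\<^sup>2) + ?S (\<lambda>i j k. (\<tau> k i j)\<^sup>2)
      + 2 * (?S (\<lambda>i j k. \<tau> j k i * \<tau> i j k) + ?S (\<lambda>i j k. \<tau> i j k * \<tau> k i j) + ?S (\<lambda>i j k. \<tau> k i j * \<tau> j k i))"
    unfolding sum_distrib_left sum.distrib[symmetric]
    by (intro sum.cong refl) (simp add: power2_eq_square algebra_simps)
  then show ?thesis
    using rotate[of "\<lambda>i j k. (\<tau> i j k)\<^sup>2"] rotate[of "\<lambda>i j k. \<tau> i j k * \<tau> k i j"] by simp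
qed

lemma torsion_norms:
  assumes p: "p \<in> U"
  shows "9/2 * norm_sq_3form M e (torsion_3form M g nab) p
      - 1/2 * norm_sq_vector_2form M g e (torsion M nab) p
    = 1/2 * (\<Sum>i\<in>I. \<Sum>j\<in>I. \<Sum>k\<in>I. g p (torsion M nab (e i) (e j) p) (e k p) * g p (torsion M nab (e k) (e i) p) (e j p))"
proof -
  let ?\<tau> = "\<lambda>i j k. g p (torsion M nab (e i) (e j) p) (e k p)"
  have t: "torsion_3form M g nab (e i) (e j) (e k) p = 1/3 * (?\<tau> j k i + ?\<tau> i j k + ?\<tau> k i j)"
    if "i \<in> I" "j \<in> I" "k \<in> I" for i j k
  proof -
    have "g p (e a p) (torsion M nab (e b) (e c) p) = ?\<tau> b c a" if "a \<in> I" "b \<in> I" "c \<in> I" for a b c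
      using that p by (intro metric_sym) (simp_all add: vf_all)
    with that show ?thesis by (simp add: torsion_3form_def)
  qed
  have "(\<Sum>i\<in>I. \<Sum>j\<in>I. \<Sum>k\<in>I. (torsion_3form M g nab (e i) (e j) (e k) p)\<^sup>2)
      = (\<Sum>i\<in>I. \<Sum>j\<in>I. \<Sum>k\<in>I. 1/9 * (?\<tau> j k i + ?\<tau> i j k + ?\<tau> k i j)\<^sup>2)"
    by (intro sum.cong refl) (simp add: t power2_eq_square)
  then have "norm_sq_3form M e (torsion_3form M g nab) p
      = 1/18 * (\<Sum>i\<in>I. \<Sum>j\<in>I. \<Sum>k\<in>I. (?\<tau> i j k)\<^sup>2) + 1/9 * (\<Sum>i\<in>I. \<Sum>j\<in>I. \<Sum>k\<in>I. ?\<tau> i j k * ?\<tau> k i j)"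
    unfolding norm_sq_3form_def sum_distrib_left[symmetric] sum_square_cyclic by simp
  moreover have "norm_sq_vector_2form M g e (torsion M nab) p
      = 1/2 * (\<Sum>i\<in>I. \<Sum>j\<in>I. \<Sum>k\<in>I. (?\<tau> i j k)\<^sup>2)"
  proof -
    have "(\<Sum>i\<in>I. \<Sum>j\<in>I. g p (torsion M nab (e i) (e j) p) (torsion M nab (e i) (e j) p))
        = (\<Sum>i\<in>I. \<Sum>j\<in>I. \<Sum>k\<in>I. ?\<tau> i j k * ?\<tau> i j k)"
      by (intro sum.cong refl parseval) (simp_all add: p vf_all)
    then show ?thesis by (simp add: norm_sq_vector_2form_def power2_eq_square)
  qed
  ultimately show ?thesis by linarith
qed

end

theorem proposition2p1:
  fixes M :: "('a, 'e::euclidean_space) manifold"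
    and J :: "'a endo_field" and g :: "'a bilin_field"
    and nab D :: "'a covd"
    and n :: nat and U :: "'a set" and e :: "nat \<Rightarrow> 'a vfield" and p :: 'a
  assumes "almost_hermitian_manifold M J g"
    and "mdim M = 2 * n"
    and "chern_connection M J g nab"
    and "levi_civita_connection M g D"
    and "adapted_frame M J g U e"
    and "p \<in> U"
  shows "chern_scalar_curvature M J g nab e p - third_scalar_curvature M g nab e p =
      1/2 * norm_sq_1form M e (torsion_1form M J g e) p
    + 1/2 * codifferential M D e (torsion_1form M J g e) p
    - 9/2 * norm_sq_3form M e (torsion_3form M g nab) p
    + 1/2 * norm_sq_vector_2form M g e (torsion M nab) p"
proof -
  note hermitian = assms(1)[unfolded almost_hermitian_manifold_def]
  note chern = assms(3)[unfolded chern_connection_def]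
  note frame = assms(5)[unfolded adapted_frame_def]
  have U: "openin (mtop M) U" by (rule frame[THEN conjunct1])
  have in_M: "q \<in> topspace (mtop M)" if "q \<in> U" for q
    using openin_subset[OF U] that by blast
  have at: "(\<forall>i\<in>{1..mdim M}. \<forall>j\<in>{1..mdim M}. g q (e i q) (e j q) = (if i = j then 1 else 0)) \<and>
      (\<forall>v\<in>tangent_space M q. \<exists>a. v = (\<Sum>i=1..mdim M. a i *\<^sub>T e i q)) \<and>
      (\<forall>\<alpha>\<in>{1..mdim M div 2}. e (2 * \<alpha>) q = J q (e (2 * \<alpha> - 1) q))" if "q \<in> U" for q
    by (rule frame[THEN conjunct2, THEN conjunct2, THEN bspec, OF that])
  interpret hermitian_frame_region M U g e nab J n
  proof unfold_locales
    show "smooth_manifold M" by (rule hermitian[THEN conjunct1])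
    show "almost_complex_structure M J" by (rule hermitian[THEN conjunct2, THEN conjunct1])
    show "riemannian_metric M g" by (rule hermitian[THEN conjunct2, THEN conjunct2, THEN conjunct1])
    show "connection M nab" by (rule chern[THEN conjunct1])
    show "metric_connection M g nab" by (rule chern[THEN conjunct2, THEN conjunct1])
    show "complex_connection M J nab" by (rule chern[THEN conjunct2, THEN conjunct2, THEN conjunct1])
    show "openin (mtop M) U" by (fact U)
    show "mdim M = 2 * n" by (fact assms(2))
    show "e i \<in> vector_fields M U" if "i \<in> {1..mdim M}" for i
      by (rule frame[THEN conjunct2, THEN conjunct1, THEN bspec, OF that])
    show "g q (e i q) (e j q) = (if i = j then 1 else 0)"
      if "q \<in> U" "i \<in> {1..mdim M}" "j \<in> {1..mdim M}" for q i j
      by (rule at[OF that(1), THEN conjunct1, THEN bspec, OF that(2), THEN bspec, OF that(3)])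
    show "\<exists>a. v = (\<Sum>i=1..mdim M. a i *\<^sub>T e i q)" if "q \<in> U" "v \<in> tangent_space M q" for q v
      by (rule at[OF that(1), THEN conjunct2, THEN conjunct1, THEN bspec, OF that(2)])
    show "e (2 * \<alpha>) q = J q (e (2 * \<alpha> - 1) q)" if "q \<in> U" "\<alpha> \<in> {1..n}" for q \<alpha>
      using that(2) assms(2)
      by (intro at[OF that(1), THEN conjunct2, THEN conjunct2, THEN bspec]) simp
    show "g q (J q u) (J q v) = g q u v"
      if "q \<in> U" "u \<in> tangent_space M q" "v \<in> tangent_space M q" for q u v
      by (rule hermitian[THEN conjunct2, THEN conjunct2, THEN conjunct2, THEN bspec, OF in_M[OF that(1)],
            THEN bspec, OF that(2), THEN bspec, OF that(3)])
    show "torsion M nab (app_field J X) (app_field J Y) q = - torsion M nab X Y q"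
      if "X \<in> vector_fields M U" "Y \<in> vector_fields M U" "q \<in> U" for X Y q
      by (rule chern[THEN conjunct2, THEN conjunct2, THEN conjunct2, rule_format, OF U that])
  qed
  show ?thesis
    using scalar_curvature_difference[OF assms(6)] codifferential_torsion_1form[OF assms(4,6)]
      torsion_norms[OF assms(6)] by linarith
qed

end
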